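(* Let $3\le n+1\le m<2n$. Let $F:\mathbb{B}^n\to D^{IV}_m$ be a holomorphic isometry which is a rational map with $F(0)=0$. Then $\deg(F)=2$.
   Context: $\mathbb{B}^n=\{z\in\mathbb{C}^n:|z|^2<1\}$; $D^{IV}_m=\{Z\in\mathbb{C}^m: Z\overline{Z}^t<2,\ 1-Z\overline{Z}^t+\tfrac14|ZZ^t|^2>0\}$. Bergman metric $\omega_\Omega=\sqrt{-1}\partial\bar\partial\log K_\Omega$ with $K_{\mathbb{B}^n}=c(1-|z|^2)^{-(n+1)}$, $K_{D^{IV}_m}=c'(1-Z\overline{Z}^t+\tfrac14|ZZ^t|^2)^{-m}$; a holomorphic $F$ is a holomorphic isometry if $F^*\omega_{D^{IV}_m}=\lambda\omega_{\mathbb{B}^n}$ for a constant $\lambda>0$. For a rational map $F=(P_1,\dots,P_m)/R$ in lowest terms, $\deg(F)=\max\{\deg P_1,\dots,\deg P_m,\deg R\}$. *)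

theory Defs
  imports "HOL-Analysis.Analysis" "HOL-Library.Poly_Mapping"
begin

definition sqnorm :: "complex ^ 'n \<Rightarrow> real" where
  "sqnorm z = (\<Sum>i\<in>UNIV. (cmod (z $ i))\<^sup>2)"

definition unit_ball_C :: "(complex ^ 'n) set" where
  "unit_ball_C = {z. sqnorm z < 1}"

definition bilin_sq :: "complex ^ 'm \<Rightarrow> complex" where
  "bilin_sq Z = (\<Sum>i\<in>UNIV. (Z $ i)\<^sup>2)"

definition QIV :: "complex ^ 'm \<Rightarrow> real" where
  "QIV Z = 1 - sqnorm Z + (cmod (bilin_sq Z))\<^sup>2 / 4"

definition type_IV_domain :: "(complex ^ 'm) set" where
  "type_IV_domain = {Z. sqnorm Z < 2 \<and> QIV Z > 0}"

text \<open>Logarithms of the Bergman kernels (additive constants log c, log c' dropped;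
  they are annihilated by ddbar).\<close>
definition logK_ball :: "complex ^ 'n \<Rightarrow> real" where
  "logK_ball z = - real (CARD('n) + 1) * ln (1 - sqnorm z)"

definition logK_IV :: "complex ^ 'm \<Rightarrow> real" where
  "logK_IV Z = - real CARD('m) * ln (QIV Z)"

text \<open>Levi form (complex Hessian) of a real function phi at z applied to v, v:
  sum_{j,k} d^2 phi / dz_j d conj(z_k) v_j conj(v_k)
  = (d^2/d zeta d conj zeta) phi(z + zeta v) at zeta = 0
  = 1/4 Laplacian of zeta |-> phi(z + zeta v) at 0.
  This gives the quadratic form of the (1,1)-form sqrt(-1) ddbar phi.\<close>
definition levi_form :: "(complex ^ 'n \<Rightarrow> real) \<Rightarrow> complex ^ 'n \<Rightarrow> complex ^ 'n \<Rightarrow> real" where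
  "levi_form \<phi> z v =
     (deriv (deriv (\<lambda>t::real. \<phi> (z + t *\<^sub>R v))) 0
    + deriv (deriv (\<lambda>t::real. \<phi> (z + t *\<^sub>R (\<i> *s v)))) 0) / 4"

definition holomorphic_map_on :: "(complex ^ 'n) set \<Rightarrow> (complex ^ 'n \<Rightarrow> complex ^ 'm) \<Rightarrow> bool" where
  "holomorphic_map_on S F \<longleftrightarrow>
     (\<forall>z\<in>S. \<exists>L. (F has_derivative L) (at z) \<and> (\<forall>c v. L (c *s v) = c *s L v))"

text \<open>Holomorphic isometry B^n -> D^IV_m: F^* omega_D = lambda omega_B,
  the pullback evaluated on (v,v): omega_D(F z)(dF_z v, dF_z v).\<close>
definition holomorphic_isometry_IV :: "(complex ^ 'n \<Rightarrow> complex ^ 'm) \<Rightarrow> bool" where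
  "holomorphic_isometry_IV F \<longleftrightarrow>
     holomorphic_map_on unit_ball_C F \<and> F ` unit_ball_C \<subseteq> type_IV_domain \<and>
     (\<exists>lam>0. \<forall>z\<in>unit_ball_C. \<forall>v.
        levi_form logK_IV (F z) (frechet_derivative F (at z) v) = lam * levi_form logK_ball z v)"

type_synonym 'n cpoly = "('n \<Rightarrow>\<^sub>0 nat) \<Rightarrow>\<^sub>0 complex"

definition cpoly_eval :: "'n cpoly \<Rightarrow> complex ^ 'n \<Rightarrow> complex" where
  "cpoly_eval p z = (\<Sum>a\<in>Poly_Mapping.keys p. Poly_Mapping.lookup p a * (\<Prod>i\<in>Poly_Mapping.keys a. (z $ i) ^ (Poly_Mapping.lookup (a::'n \<Rightarrow>\<^sub>0 nat) i)))"

definition cpoly_deg :: "'n cpoly \<Rightarrow> nat" where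
  "cpoly_deg p = Max (insert 0 ((\<lambda>a::'n \<Rightarrow>\<^sub>0 nat. \<Sum>i\<in>Poly_Mapping.keys a. Poly_Mapping.lookup a i) ` Poly_Mapping.keys p))"

definition lowest_terms_rep :: "(complex ^ 'n) set \<Rightarrow> (complex ^ 'n \<Rightarrow> complex ^ 'm)
     \<Rightarrow> ('m \<Rightarrow> 'n cpoly) \<Rightarrow> 'n cpoly \<Rightarrow> bool" where
  "lowest_terms_rep S F P R \<longleftrightarrow>
     R \<noteq> 0 \<and>
     (\<forall>d. (\<forall>j. d dvd P j) \<and> d dvd R \<longrightarrow> d dvd 1) \<and>
     (\<forall>z\<in>S. cpoly_eval R z \<noteq> 0 \<longrightarrow> F z = (\<chi> j. cpoly_eval (P j) z / cpoly_eval R z))"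

definition rational_map_on :: "(complex ^ 'n) set \<Rightarrow> (complex ^ 'n \<Rightarrow> complex ^ 'm) \<Rightarrow> bool" where
  "rational_map_on S F \<longleftrightarrow> (\<exists>P R. lowest_terms_rep S F P R)"

definition rep_deg :: "('m::finite \<Rightarrow> 'n cpoly) \<Rightarrow> 'n cpoly \<Rightarrow> nat" where
  "rep_deg P R = max (Max (range (\<lambda>j. cpoly_deg (P j)))) (cpoly_deg R)"

end

theory Submission
  imports Defs "HOL-Complex_Analysis.Complex_Analysis"
    "HOL-Computational_Algebra.Fundamental_Theorem_Algebra"
begin

text \<open>
  Put \<open>\<mu> = \<lambda> (n + 1) / m\<close>. Polarising the Levi form identity along complex lines through the origin and
  integrating it twice, \<open>F\<close> turns the kernel \<open>Q(Z, W) = 1 - \<langle>Z, W\<rangle> + (Z \<cdot> Z) cnj (W \<cdot> W) / 4\<close> of the type IV domain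
  into \<open>(1 - \<langle>z, w\<rangle>)\<^sup>\<mu>\<close> near the origin. Rationality makes \<open>\<mu>\<close> an integer, and the second-order expansion in a
  direction \<open>u\<close> with \<open>F'(0)u \<cdot> F'(0)u = 0\<close>, which exists as \<open>n \<ge> 2\<close>, gives \<open>\<mu> \<le> 1\<close>; so \<open>\<mu> = 1\<close>.

  With \<open>f = F \<cdot> F / 2\<close> this reads \<open>\<langle>F z, F w\<rangle> = \<langle>z, w\<rangle> + f(z) cnj (f(w))\<close>. Hence \<open>L = F'(0)\<close> is isometric and
  \<open>F = L + f a\<close> for a unit vector \<open>a\<close> orthogonal to the image of \<open>L\<close>. Since \<open>m < 2n\<close>, that image is not totally
  isotropic, so the quadratic form \<open>q(z) = L z \<cdot> L z\<close> does not vanish identically. Squaring \<open>F = L + f a\<close> yields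
  \<open>(a \<cdot> a) f\<^sup>2 - 2 (1 - L z \<cdot> a) f + q = 0\<close>. Rationality of \<open>f\<close> forces \<open>a \<cdot> a = 0\<close>, so
  \<open>F = L + q a / (2 (1 - L z \<cdot> a))\<close>. The denominator cannot cancel, and the quadratic part of the numerator
  is nonzero because \<open>a\<close> is orthogonal to the image of \<open>L\<close>.
\<close>

section \<open>Polynomials as functions\<close>

text \<open>The product runs over all coordinates instead of the support of \<open>a\<close>, so
  that exponents add with no bookkeeping of supports.\<close>

definition mono_eval :: "('n::finite \<Rightarrow>\<^sub>0 nat) \<Rightarrow> complex ^ 'n \<Rightarrow> complex" where
  "mono_eval a z = (\<Prod>i\<in>UNIV. (z $ i) ^ Poly_Mapping.lookup a i)"

definition mono_deg :: "('n::finite \<Rightarrow>\<^sub>0 nat) \<Rightarrow> nat" where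
  "mono_deg a = (\<Sum>i\<in>UNIV. Poly_Mapping.lookup a i)"

lemma mono_eval_add: "mono_eval (a + b) z = mono_eval a z * mono_eval b z"
  by (simp add: mono_eval_def lookup_add power_add prod.distrib)

lemma mono_eval_0 [simp]: "mono_eval 0 z = 1"
  by (simp add: mono_eval_def)

lemma mono_deg_add: "mono_deg (a + b) = mono_deg a + mono_deg b"
  by (simp add: mono_deg_def lookup_add sum.distrib)

lemma cpoly_eval_eq_sum:
  assumes "finite S" "Poly_Mapping.keys p \<subseteq> S"
  shows "cpoly_eval p z = (\<Sum>a\<in>S. Poly_Mapping.lookup p a * mono_eval a z)"
proof -
  have "(\<Prod>i\<in>Poly_Mapping.keys a. (z $ i) ^ Poly_Mapping.lookup a i) = mono_eval a z" for a
    unfolding mono_eval_def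
    by (rule prod.mono_neutral_left) (auto simp: in_keys_iff)
  then have "cpoly_eval p z = (\<Sum>a\<in>Poly_Mapping.keys p. Poly_Mapping.lookup p a * mono_eval a z)"
    by (simp add: cpoly_eval_def)
  also have "\<dots> = (\<Sum>a\<in>S. Poly_Mapping.lookup p a * mono_eval a z)"
    using assms by (intro sum.mono_neutral_left) (auto simp: in_keys_iff)
  finally show ?thesis .
qed

lemma cpoly_eval_add: "cpoly_eval (p + q) z = cpoly_eval p z + cpoly_eval q z"
proof -
  let ?S = "Poly_Mapping.keys p \<union> Poly_Mapping.keys q"
  have "Poly_Mapping.keys (p + q) \<subseteq> ?S" by (rule Poly_Mapping.keys_add)
  then show ?thesis
    by (simp add: cpoly_eval_eq_sum[of ?S] lookup_add algebra_simps sum.distrib)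
qed

lemma cpoly_eval_single: "cpoly_eval (Poly_Mapping.single a c) z = c * mono_eval a z"
  by (subst cpoly_eval_eq_sum[of "{a}"]) auto

lemma cpoly_eval_0 [simp]: "cpoly_eval 0 z = 0"
  by (simp add: cpoly_eval_def)

lemma cpoly_eval_1 [simp]: "cpoly_eval 1 z = 1"
  by (simp add: cpoly_eval_single flip: single_one)

text \<open>Serves at two levels: a polynomial is a sum of terms, and an exponent vector is a sum of
  exponents of single variables.\<close>

lemma poly_mapping_add_induct [case_names single add]:
  fixes p :: "'a \<Rightarrow>\<^sub>0 'b::comm_monoid_add"
  assumes single: "\<And>a c. P (Poly_Mapping.single a c)"
    and add: "\<And>p q. P p \<Longrightarrow> P q \<Longrightarrow> P (p + q)"
  shows "P p"
proof (induction p rule: update_induct)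
  case const
  then show ?case using single[of undefined 0] by simp
next
  case (update f a b)
  have "Poly_Mapping.update a b f = Poly_Mapping.single a b + f"
    using update(1) by (intro poly_mapping_eqI)
      (auto simp: lookup_add lookup_update lookup_single in_keys_iff when_def)
  then show ?case using add[OF single update(3)] by simp
qed

lemma cpoly_eval_mult: "cpoly_eval (p * q) z = cpoly_eval p z * cpoly_eval q z"
proof (induction p rule: poly_mapping_add_induct)
  case (single a c)
  show ?case
    by (induction q rule: poly_mapping_add_induct)
      (simp_all add: mult_single cpoly_eval_single mono_eval_add cpoly_eval_add algebra_simps)
qed (simp add: cpoly_eval_add algebra_simps)

lemma cpoly_eval_uminus: "cpoly_eval (- p) z = - cpoly_eval p z"
  using cpoly_eval_add[of p "- p" z] by (simp add: add_eq_0_iff)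

lemma cpoly_eval_diff: "cpoly_eval (p - q) z = cpoly_eval p z - cpoly_eval q z"
  using cpoly_eval_add[of p "- q" z] by (simp add: cpoly_eval_uminus)

lemma cpoly_eval_sum: "cpoly_eval (\<Sum>i\<in>A. p i) z = (\<Sum>i\<in>A. cpoly_eval (p i) z)"
  by (induction A rule: infinite_finite_induct) (simp_all add: cpoly_eval_add)

text \<open>Dedekind's independence of characters, applied to the monomials on the multiplicative monoid \<open>\<complex>\<^sup>n\<close>.\<close>

lemma monomials_independent:
  fixes c :: "('n::finite \<Rightarrow>\<^sub>0 nat) \<Rightarrow> complex"
  assumes "finite S" "\<And>z. (\<Sum>a\<in>S. c a * mono_eval a z) = 0" "a \<in> S"
  shows "c a = 0"
  using assms
proof (induction S arbitrary: c a rule: finite_induct)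
  case empty
  then show ?case by simp
next
  case (insert b S)
  have mul: "mono_eval x (\<chi> i. w $ i * z $ i) = mono_eval x w * mono_eval x z" for x w z
    by (simp add: mono_eval_def power_mult_distrib prod.distrib)
  have z0: "c b * mono_eval b z + (\<Sum>a\<in>S. c a * mono_eval a z) = 0" for z
    using insert.prems(1)[of z] insert.hyps by simp
  have z1: "(\<Sum>a\<in>S. c a * mono_eval a z) = - (c b * mono_eval b z)" for z
    using z0[of z] by (simp add: eq_neg_iff_add_eq_0 add.commute)
  \<comment> \<open>Replacing \<open>z\<close> by the coordinatewise product with \<open>w\<close>
    and subtracting \<open>mono_eval b w\<close> times the original relation cancels the
    \<open>b\<close> term and leaves a relation over \<open>S\<close>.\<close>
  have "(\<Sum>a\<in>S. (c a * (mono_eval a w - mono_eval b w)) * mono_eval a z) = 0" for w z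
  proof -
    have "(\<Sum>a\<in>S. (c a * (mono_eval a w - mono_eval b w)) * mono_eval a z) =
        (\<Sum>a\<in>S. c a * mono_eval a (\<chi> i. w $ i * z $ i)) - mono_eval b w * (\<Sum>a\<in>S. c a * mono_eval a z)"
      by (simp add: mul algebra_simps sum_subtractf sum_distrib_left)
    also have "\<dots> = - (c b * mono_eval b (\<chi> i. w $ i * z $ i)) - mono_eval b w * (- (c b * mono_eval b z))"
      unfolding z1 ..
    also have "\<dots> = 0" by (simp add: mul)
    finally show ?thesis .
  qed
  from insert.IH[OF this] have eq: "c a * (mono_eval a w - mono_eval b w) = 0" if "a \<in> S" for a w
    using that by blast
  have S0: "c a = 0" if "a \<in> S" for a
  proof -
    have "a \<noteq> b" using that insert.hyps by auto
    then obtain i where i: "Poly_Mapping.lookup a i \<noteq> Poly_Mapping.lookup b i"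
      using poly_mapping_eqI[of a b] by auto
    \<comment> \<open>The point with 2 in coordinate \<open>i\<close> and 1 elsewhere separates
      \<open>a\<close> from \<open>b\<close>, since powers of 2 with distinct exponents
      differ.\<close>
    have "mono_eval x (\<chi> j. if j = i then 2 else 1) = 2 ^ Poly_Mapping.lookup x i" for x
    proof -
      have "mono_eval x (\<chi> j. if j = i then 2 else 1) =
          (\<Prod>j\<in>UNIV. if j = i then 2 ^ Poly_Mapping.lookup x i else 1)"
        unfolding mono_eval_def by (intro prod.cong) auto
      then show ?thesis by simp
    qed
    moreover have "(2::complex) ^ Poly_Mapping.lookup a i \<noteq> 2 ^ Poly_Mapping.lookup b i"
      using i by (metis norm_numeral norm_power power_inject_exp one_less_numeral_iff semiring_norm(76))
    ultimately show ?thesis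
      using eq[OF that, of "\<chi> j. if j = i then 2 else 1"] by simp
  qed
  have "mono_eval b (\<chi> i. 1) = 1" by (simp add: mono_eval_def)
  then have "c b = 0" using z0[of "\<chi> i. 1"] S0 by simp
  then show ?case using insert.prems S0 by auto
qed

lemma cpoly_eval_inject:
  assumes "\<And>z. cpoly_eval p z = cpoly_eval q z"
  shows "p = q"
proof -
  have "(\<Sum>a\<in>Poly_Mapping.keys (p - q). Poly_Mapping.lookup (p - q) a * mono_eval a z) = 0" for z
    using assms[of z] cpoly_eval_eq_sum[of "Poly_Mapping.keys (p - q)" "p - q" z]
    by (simp add: cpoly_eval_diff)
  then have "a \<in> Poly_Mapping.keys (p - q) \<Longrightarrow> Poly_Mapping.lookup (p - q) a = 0" for a
    using monomials_independent[of "Poly_Mapping.keys (p - q)"] by auto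
  then have "p - q = 0"
    by (metis in_keys_iff keys_eq_empty equals0I)
  then show ?thesis by simp
qed

text \<open>Reduces questions in several variables to univariate polynomials, which have finitely
  many roots and form an integral domain.\<close>

lemma cpoly_eval_affine_line:
  "\<exists>r. \<forall>t. cpoly_eval p (x + t *s v) = poly r t"
proof (intro exI allI)
  fix t
  show "cpoly_eval p (x + t *s v) =
      poly (\<Sum>a\<in>Poly_Mapping.keys p. [:Poly_Mapping.lookup p a:] *
        (\<Prod>i\<in>UNIV. [:x $ i, v $ i:] ^ Poly_Mapping.lookup a i)) t"
    by (simp add: cpoly_eval_eq_sum[of "Poly_Mapping.keys p"] poly_sum poly_prod mono_eval_def)
qed

lemma mono_eval_scale: "mono_eval a (t *s v) = t ^ mono_deg a * mono_eval a v"
  by (simp add: mono_eval_def mono_deg_def power_mult_distrib prod.distrib power_sum)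

lemma cpoly_deg_le_iff:
  fixes p :: "'n::finite cpoly"
  shows "cpoly_deg p \<le> d \<longleftrightarrow> (\<forall>a\<in>Poly_Mapping.keys p. mono_deg a \<le> d)"
proof -
  have "(\<Sum>i\<in>Poly_Mapping.keys a. Poly_Mapping.lookup a i) = mono_deg a" for a :: "'n \<Rightarrow>\<^sub>0 nat"
    unfolding mono_deg_def
    by (rule sum.mono_neutral_left) (auto simp: in_keys_iff)
  then show ?thesis by (simp add: cpoly_deg_def)
qed

lemma cpoly_eval_line:
  assumes "cpoly_deg p \<le> d"
  shows "\<exists>r. degree r \<le> d \<and> (\<forall>t. cpoly_eval p (t *s v) = poly r t)"
proof (intro exI conjI allI)
  let ?r = "\<Sum>a\<in>Poly_Mapping.keys p. monom (Poly_Mapping.lookup p a * mono_eval a v) (mono_deg a)"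
  show "degree ?r \<le> d"
    using assms unfolding cpoly_deg_le_iff
    by (intro degree_sum_le) (auto intro: order_trans[OF degree_monom_le])
  fix t
  show "cpoly_eval p (t *s v) = poly ?r t"
    by (simp add: cpoly_eval_eq_sum[of "Poly_Mapping.keys p"] poly_sum poly_monom mono_eval_scale mult_ac)
qed

lemma cpoly_deg_add:
  fixes p q :: "'n::finite cpoly"
  shows "cpoly_deg p \<le> d \<Longrightarrow> cpoly_deg q \<le> d \<Longrightarrow> cpoly_deg (p + q) \<le> d"
  using Poly_Mapping.keys_add[of p q] unfolding cpoly_deg_le_iff by blast

lemma cpoly_deg_sum:
  fixes p :: "'i \<Rightarrow> 'n::finite cpoly"
  shows "(\<And>i. i \<in> A \<Longrightarrow> cpoly_deg (p i) \<le> d) \<Longrightarrow> cpoly_deg (\<Sum>i\<in>A. p i) \<le> d"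
proof (induction A rule: infinite_finite_induct)
  case (insert x F)
  then show ?case by (simp add: cpoly_deg_add)
qed (simp_all add: cpoly_deg_le_iff)

lemma cpoly_deg_mult:
  fixes p q :: "'n::finite cpoly"
  assumes "cpoly_deg p \<le> d" "cpoly_deg q \<le> e"
  shows "cpoly_deg (p * q) \<le> d + e"
  unfolding cpoly_deg_le_iff
proof
  fix a assume "a \<in> Poly_Mapping.keys (p * q)"
  then obtain b c where "a = b + c" "b \<in> Poly_Mapping.keys p" "c \<in> Poly_Mapping.keys q"
    using keys_mult[of p q] by auto
  then show "mono_deg a \<le> d + e"
    using assms by (auto simp: cpoly_deg_le_iff mono_deg_add intro: add_mono)
qed

abbreviation cpoly_const :: "complex \<Rightarrow> 'n::finite cpoly" where
  "cpoly_const c \<equiv> Poly_Mapping.single 0 c"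

abbreviation cpoly_var :: "'n::finite \<Rightarrow> 'n cpoly" where
  "cpoly_var i \<equiv> Poly_Mapping.single (Poly_Mapping.single i (Suc 0)) 1"

lemma mono_eval_var: "mono_eval (Poly_Mapping.single i n) z = (z $ i) ^ n"
proof -
  have "mono_eval (Poly_Mapping.single i n) z = (\<Prod>j\<in>UNIV. if j = i then (z $ i) ^ n else 1)"
    unfolding mono_eval_def by (intro prod.cong) (auto simp: lookup_single)
  then show ?thesis by simp
qed

lemma cpoly_eval_var [simp]: "cpoly_eval (cpoly_var i) z = z $ i"
  by (simp add: cpoly_eval_single mono_eval_var)

lemma cpoly_eval_const [simp]: "cpoly_eval (cpoly_const c) z = c"
  by (simp add: cpoly_eval_single)

lemma cpoly_deg_const: "cpoly_deg (cpoly_const c) \<le> d"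
  by (simp add: cpoly_deg_le_iff mono_deg_def)

lemma cpoly_deg_var: "cpoly_deg (cpoly_var (i::'n::finite)) \<le> 1"
proof -
  have "mono_deg (Poly_Mapping.single i (Suc 0)) = (\<Sum>j\<in>UNIV. if j = i then 1 else 0)"
    unfolding mono_deg_def by (intro sum.cong) (auto simp: lookup_single)
  then show ?thesis by (simp add: cpoly_deg_le_iff)
qed

lemma cpoly_induct [case_names const var add mult]:
  fixes p :: "'n::finite cpoly"
  assumes const: "\<And>c. P (cpoly_const c)" and var: "\<And>i. P (cpoly_var i)"
    and add: "\<And>p q. P p \<Longrightarrow> P q \<Longrightarrow> P (p + q)" and mult: "\<And>p q. P p \<Longrightarrow> P q \<Longrightarrow> P (p * q)"
  shows "P p"
proof (induction p rule: poly_mapping_add_induct)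
  case (single a c)
  have "P (Poly_Mapping.single a 1)"
  proof (induction a rule: poly_mapping_add_induct)
    case (single i n)
    show ?case
    proof (induction n)
      case 0
      then show ?case using const[of 1] by simp
    next
      case (Suc n)
      have "Poly_Mapping.single (Poly_Mapping.single i (Suc n)) 1 =
          cpoly_var i * (Poly_Mapping.single (Poly_Mapping.single i n) 1 :: 'n cpoly)"
        by (simp add: mult_single flip: single_add)
      then show ?case using mult[OF var Suc] by simp
    qed
  next
    case (add a b)
    have "Poly_Mapping.single (a + b) 1 = Poly_Mapping.single a 1 * (Poly_Mapping.single b 1 :: 'n cpoly)"
      by (simp add: mult_single)
    then show ?case using mult[OF add] by simp
  qed
  then have "P (cpoly_const c * Poly_Mapping.single a 1)"
    by (intro mult const)
  then show ?case by (simp add: mult_single)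
next
  case (add f g)
  then show ?case by (rule assms(3))
qed

section \<open>Zero sets, units and division by an affine form\<close>

lemma cpoly_eval_prod_zero_on_affine:
  assumes line: "\<And>x y t. x \<in> V \<Longrightarrow> y \<in> V \<Longrightarrow> x + t *s (y - x) \<in> V"
    and zero: "\<And>z. z \<in> V \<Longrightarrow> cpoly_eval p z * cpoly_eval q z = 0"
    and "x \<in> V" "cpoly_eval p x \<noteq> 0" "y \<in> V"
  shows "cpoly_eval q y = 0"
proof -
  \<comment> \<open>The line through \<open>x\<close> and \<open>y\<close> stays in
    \<open>V\<close>. On it the product is the zero polynomial, while the first factor is nonzero at
    parameter 0.\<close>
  obtain r where r: "\<And>t. cpoly_eval p (x + t *s (y - x)) = poly r t"
    using cpoly_eval_affine_line by blast
  obtain s where s: "\<And>t. cpoly_eval q (x + t *s (y - x)) = poly s t"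
    using cpoly_eval_affine_line by blast
  have "poly (r * s) t = 0" for t
    using zero[OF line[OF assms(3,5), of t]] by (simp only: r s poly_mult)
  then have "r * s = 0" using poly_all_0_iff_0 by blast
  moreover have "r \<noteq> 0" using r[of 0] assms(4) by auto
  ultimately have "s = 0" by simp
  then show ?thesis using s[of 1] by simp
qed

lemma cpoly_mult_eq_0:
  fixes p q :: "'n::finite cpoly"
  assumes "p * q = 0" "p \<noteq> 0"
  shows "q = 0"
proof -
  obtain x where "cpoly_eval p x \<noteq> 0"
    using cpoly_eval_inject[of p 0] assms(2) by auto
  then have "cpoly_eval q y = 0" for y
    using cpoly_eval_prod_zero_on_affine[of UNIV p q x y] assms(1)
    by (simp flip: cpoly_eval_mult)
  then show ?thesis by (intro cpoly_eval_inject) simp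
qed

lemma poly_eq_0_near_0:
  fixes r :: "complex poly"
  assumes "e > 0" "\<And>t. cmod t < e \<Longrightarrow> poly r t = 0"
  shows "r = 0"
proof (rule ccontr)
  assume "r \<noteq> 0"
  then have "finite {t. poly r t = 0}" by (rule poly_roots_finite)
  moreover have "ball 0 e \<subseteq> {t. poly r t = 0}" using assms(2) by auto
  ultimately have "finite (ball (0::complex) e)" by (rule finite_subset[rotated])
  then show False
    using assms(1) uncountable_ball[of e "0::complex"] countable_finite by blast
qed

lemma sqnorm_scale: "sqnorm (t *s v) = (cmod t)\<^sup>2 * sqnorm v"
  by (simp add: sqnorm_def norm_mult power_mult_distrib sum_distrib_left)

lemma sqnorm_nonneg: "0 \<le> sqnorm z"
  by (simp add: sqnorm_def sum_nonneg)

lemma small_scale_in_ball: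
  assumes "\<rho> > 0"
  obtains e where "e > 0" "\<And>t. cmod t < e \<Longrightarrow> sqnorm (t *s v) < \<rho>"
proof
  \<comment> \<open>The summand 1 keeps the denominator positive when \<open>v = 0\<close>.\<close>
  show "sqrt (\<rho> / (sqnorm v + 1)) > 0" using assms sqnorm_nonneg[of v] by simp
  fix t assume "cmod t < sqrt (\<rho> / (sqnorm v + 1))"
  then have "(cmod t)\<^sup>2 < \<rho> / (sqnorm v + 1)"
    by (metis norm_ge_zero real_less_rsqrt real_sqrt_less_iff real_sqrt_abs abs_norm_cancel)
  then have "(cmod t)\<^sup>2 * (sqnorm v + 1) < \<rho>"
    using sqnorm_nonneg[of v] by (simp add: field_simps)
  then show "sqnorm (t *s v) < \<rho>"
    unfolding sqnorm_scale using zero_le_power2[of "cmod t"] unfolding distrib_left by linarith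
qed

lemma cpoly_eq_near_0:
  assumes "\<rho> > 0" "\<And>z. sqnorm z < \<rho> \<Longrightarrow> cpoly_eval p z = cpoly_eval q z"
  shows "p = q"
proof (rule cpoly_eval_inject)
  fix z
  obtain r where r: "\<And>t. cpoly_eval (p - q) (0 + t *s z) = poly r t"
    using cpoly_eval_affine_line by blast
  obtain e where e: "e > 0" "\<And>t. cmod t < e \<Longrightarrow> sqnorm (t *s z) < \<rho>"
    using small_scale_in_ball[OF assms(1)] by blast
  have "poly r t = 0" if "cmod t < e" for t
    using assms(2)[OF e(2)[OF that]] r[of t] by (simp add: cpoly_eval_diff)
  then have "r = 0" using poly_eq_0_near_0 e(1) by blast
  then show "cpoly_eval p z = cpoly_eval q z"
    using r[of 1] by (simp add: cpoly_eval_diff)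
qed

text \<open>On each line through 0 a divisor of 1 restricts to a unit among univariate polynomials,
  hence to a constant.\<close>

lemma cpoly_unit_const:
  assumes "d dvd (1 :: 'n::finite cpoly)"
  obtains c where "c \<noteq> 0" "d = cpoly_const c"
proof -
  obtain e where de: "1 = d * e" using assms by (auto simp: dvd_def)
  have c: "cpoly_eval d z = cpoly_eval d 0" for z
  proof -
    obtain r where r: "\<And>t. cpoly_eval d (0 + t *s z) = poly r t"
      using cpoly_eval_affine_line by blast
    obtain s where s: "\<And>t. cpoly_eval e (0 + t *s z) = poly s t"
      using cpoly_eval_affine_line by blast
    have "poly (r * s) t = poly 1 t" for t
      using arg_cong[OF de, of "\<lambda>x. cpoly_eval x (0 + t *s z)"] by (simp add: cpoly_eval_mult r[simplified] s[simplified])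
    then have "r * s = 1" by (intro poly_eq_poly_eq_iff[THEN iffD1] ext)
    then have "r dvd 1" by (metis dvd_triv_left)
    then obtain k where "r = [:k:]" by (auto simp: is_unit_poly_iff)
    then show ?thesis using r[of 1] r[of 0] by simp
  qed
  have "cpoly_eval d 0 \<noteq> 0"
    using arg_cong[OF de, of "\<lambda>x. cpoly_eval x 0"] by (auto simp: cpoly_eval_mult)
  moreover have "d = cpoly_const (cpoly_eval d 0)"
    using c by (intro cpoly_eval_inject) simp
  ultimately show ?thesis using that by blast
qed

definition cpoly_linear :: "('n::finite \<Rightarrow> complex) \<Rightarrow> 'n cpoly" where
  "cpoly_linear b = (\<Sum>i\<in>UNIV. cpoly_const (b i) * cpoly_var i)"

lemma cpoly_eval_linear: "cpoly_eval (cpoly_linear b) z = (\<Sum>i\<in>UNIV. b i * z $ i)"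
  by (simp add: cpoly_linear_def cpoly_eval_sum cpoly_eval_mult)

lemma cpoly_deg_linear: "cpoly_deg (cpoly_linear b) \<le> 1"
  unfolding cpoly_linear_def
  using cpoly_deg_mult[OF cpoly_deg_const[of _ 0] cpoly_deg_var] by (intro cpoly_deg_sum) simp

text \<open>Every polynomial is congruent modulo \<open>D\<close> to its pullback under a projection
  onto the hyperplane \<open>D = 0\<close>, and for \<open>R\<close> this pullback is zero. If all
  \<open>b i\<close> vanish, then \<open>D = 1\<close>.\<close>

lemma cpoly_vanishing_on_hyperplane:
  fixes b :: "'n::finite \<Rightarrow> complex"
  defines "D \<equiv> 1 - cpoly_linear b"
  assumes zero: "\<And>z. cpoly_eval D z = 0 \<Longrightarrow> cpoly_eval R z = 0"
  obtains S where "R = D * S"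
proof (cases "\<forall>i. b i = 0")
  case True
  then have "cpoly_linear b = 0"
    by (intro cpoly_eval_inject) (simp add: cpoly_eval_linear)
  then show ?thesis using that[of R] by (simp add: D_def)
next
  case False
  then obtain k where k: "b k \<noteq> 0" by blast
  \<comment> \<open>This is coordinate \<open>k\<close> solved from \<open>D = 0\<close>: adding
    \<open>D / b k\<close> cancels the variable \<open>k\<close>.\<close>
  define e where "e = cpoly_var k + cpoly_const (1 / b k) * D"
  define \<sigma> where "\<sigma> z = (\<chi> i. if i = k then cpoly_eval e z else z $ i)" for z
  have D\<sigma>: "cpoly_eval D (\<sigma> z) = 0" for z
  proof -
    have "(\<Sum>i\<in>UNIV. b i * \<sigma> z $ i) = b k * cpoly_eval e z + (\<Sum>i\<in>UNIV - {k}. b i * z $ i)"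
      by (subst sum.remove[of _ k]) (auto simp: \<sigma>_def intro!: sum.cong)
    moreover have "(\<Sum>i\<in>UNIV. b i * z $ i) = b k * z $ k + (\<Sum>i\<in>UNIV - {k}. b i * z $ i)"
      by (subst sum.remove[of _ k]) auto
    ultimately show ?thesis
      using k by (simp add: D_def e_def cpoly_eval_diff cpoly_eval_add cpoly_eval_mult cpoly_eval_linear field_simps)
  qed
  \<comment> \<open>Substitution respects sums and products, so the congruence reduces to constants
    and variables. Only variable \<open>k\<close> changes, by \<open>D / b k\<close>.\<close>
  have "\<exists>p' s. p = p' + D * s \<and> (\<forall>z. cpoly_eval p' z = cpoly_eval p (\<sigma> z))" for p
  proof (induction p rule: cpoly_induct)
    case (const c)
    then show ?case by (intro exI[of _ "cpoly_const c"] exI[of _ 0]) simp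
  next
    case (var i)
    show ?case
    proof (cases "i = k")
      case True
      then show ?thesis
        by (intro exI[of _ e] exI[of _ "- cpoly_const (1 / b k)"]) (simp add: e_def \<sigma>_def)
    next
      case False
      then show ?thesis by (intro exI[of _ "cpoly_var i"] exI[of _ 0]) (simp add: \<sigma>_def)
    qed
  next
    case (add p q)
    then obtain p' s q' t where *: "p = p' + D * s" "q = q' + D * t"
      and **: "\<And>z. cpoly_eval p' z = cpoly_eval p (\<sigma> z)" "\<And>z. cpoly_eval q' z = cpoly_eval q (\<sigma> z)"
      by blast
    show ?case
      by (intro exI[of _ "p' + q'"] exI[of _ "s + t"] conjI allI)
        (simp add: *(1,2) algebra_simps, simp only: ** cpoly_eval_add)
  next
    case (mult p q)
    then obtain p' s q' t where *: "p = p' + D * s" "q = q' + D * t"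
      and **: "\<And>z. cpoly_eval p' z = cpoly_eval p (\<sigma> z)" "\<And>z. cpoly_eval q' z = cpoly_eval q (\<sigma> z)"
      by blast
    show ?case
      by (intro exI[of _ "p' * q'"] exI[of _ "s * q' + p' * t + D * s * t"] conjI allI)
        (simp add: *(1,2) algebra_simps, simp only: ** cpoly_eval_mult)
  qed
  then obtain p' s where R: "R = p' + D * s" "\<And>z. cpoly_eval p' z = cpoly_eval R (\<sigma> z)" by blast
  have "p' = 0" using R(2) zero[OF D\<sigma>] by (intro cpoly_eval_inject) simp
  then show ?thesis using R(1) that by simp
qed

section \<open>Polarisation\<close>

text \<open>Functions of \<open>\<zeta>\<close> and \<open>cnj \<omega>\<close> generated by holomorphic ones. Such a function is determined by its
  values on the diagonal \<open>\<zeta> = \<omega>\<close>.\<close>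

inductive sesqui :: "complex set \<Rightarrow> (complex \<Rightarrow> complex \<Rightarrow> complex) \<Rightarrow> bool" for S where
  left: "g holomorphic_on S \<Longrightarrow> sesqui S (\<lambda>\<zeta> \<omega>. g \<zeta>)"
| right: "g holomorphic_on S \<Longrightarrow> sesqui S (\<lambda>\<zeta> \<omega>. cnj (g \<omega>))"
| add: "sesqui S G \<Longrightarrow> sesqui S H \<Longrightarrow> sesqui S (\<lambda>\<zeta> \<omega>. G \<zeta> \<omega> + H \<zeta> \<omega>)"
| mult: "sesqui S G \<Longrightarrow> sesqui S H \<Longrightarrow> sesqui S (\<lambda>\<zeta> \<omega>. G \<zeta> \<omega> * H \<zeta> \<omega>)"

lemma sesqui_const: "sesqui S (\<lambda>\<zeta> \<omega>. c)"
  by (rule sesqui.left) simp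

lemma sesqui_uminus: "sesqui S G \<Longrightarrow> sesqui S (\<lambda>\<zeta> \<omega>. - G \<zeta> \<omega>)"
  using sesqui.mult[OF sesqui_const[of S "-1"]] by simp

lemma sesqui_diff: "sesqui S G \<Longrightarrow> sesqui S H \<Longrightarrow> sesqui S (\<lambda>\<zeta> \<omega>. G \<zeta> \<omega> - H \<zeta> \<omega>)"
  using sesqui.add[OF _ sesqui_uminus] by simp

lemma sesqui_power: "sesqui S G \<Longrightarrow> sesqui S (\<lambda>\<zeta> \<omega>. G \<zeta> \<omega> ^ n)"
  by (induction n) (auto intro: sesqui.mult sesqui_const)

lemma sesqui_sum: "(\<And>i. i \<in> A \<Longrightarrow> sesqui S (G i)) \<Longrightarrow> sesqui S (\<lambda>\<zeta> \<omega>. \<Sum>i\<in>A. G i \<zeta> \<omega>)"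
  by (induction A rule: infinite_finite_induct) (auto intro: sesqui.add sesqui_const)

lemma sesqui_divide: "sesqui S G \<Longrightarrow> sesqui S (\<lambda>\<zeta> \<omega>. G \<zeta> \<omega> / c)"
  unfolding divide_inverse by (intro sesqui.mult sesqui_const)

text \<open>Couples the partial derivative in the first variable, taken off the diagonal, with the
  real differential along the diagonal: \<open>G1\<close> is also the complex-linear part of the
  latter, and \<open>G2\<close> is its conjugate-linear coefficient.\<close>

definition sesqui_deriv :: "complex set \<Rightarrow> (complex \<Rightarrow> complex \<Rightarrow> complex) \<Rightarrow>
    (complex \<Rightarrow> complex \<Rightarrow> complex) \<Rightarrow> (complex \<Rightarrow> complex) \<Rightarrow> bool" where
  "sesqui_deriv S G G1 G2 \<longleftrightarrow> (\<forall>\<zeta>\<in>S.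
    (\<forall>\<omega>\<in>S. ((\<lambda>x. G x \<omega>) has_field_derivative G1 \<zeta> \<omega>) (at \<zeta>)) \<and>
    ((\<lambda>x. G x x) has_derivative (\<lambda>h. G1 \<zeta> \<zeta> * h + G2 \<zeta> * cnj h)) (at \<zeta>))"

lemma sesqui_derivI:
  assumes "\<And>\<zeta> \<omega>. \<zeta> \<in> S \<Longrightarrow> \<omega> \<in> S \<Longrightarrow> ((\<lambda>x. G x \<omega>) has_field_derivative G1 \<zeta> \<omega>) (at \<zeta>)"
    and "\<And>\<zeta>. \<zeta> \<in> S \<Longrightarrow> ((\<lambda>x. G x x) has_derivative (\<lambda>h. G1 \<zeta> \<zeta> * h + G2 \<zeta> * cnj h)) (at \<zeta>)"
  shows "sesqui_deriv S G G1 G2"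
  using assms by (simp add: sesqui_deriv_def)

lemma sesqui_derivD:
  assumes "sesqui_deriv S G G1 G2" "\<zeta> \<in> S"
  shows "\<omega> \<in> S \<Longrightarrow> ((\<lambda>x. G x \<omega>) has_field_derivative G1 \<zeta> \<omega>) (at \<zeta>)"
    and "((\<lambda>x. G x x) has_derivative (\<lambda>h. G1 \<zeta> \<zeta> * h + G2 \<zeta> * cnj h)) (at \<zeta>)"
  using assms by (simp_all add: sesqui_deriv_def)

text \<open>That \<open>G1\<close> is again of the same class is what allows iteration.\<close>

lemma sesqui_derivative:
  assumes "sesqui S G" "open S"
  shows "\<exists>G1 G2. sesqui S G1 \<and> sesqui_deriv S G G1 G2"
  using assms(1)
proof induction
  case (left g)
  have d: "(g has_field_derivative deriv g \<zeta>) (at \<zeta>)" if "\<zeta> \<in> S" for \<zeta>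
    using holomorphic_derivI[OF left \<open>open S\<close> that] .
  have "sesqui_deriv S (\<lambda>\<zeta> \<omega>. g \<zeta>) (\<lambda>\<zeta> \<omega>. deriv g \<zeta>) (\<lambda>_. 0)"
  proof (rule sesqui_derivI)
    fix \<zeta> assume "\<zeta> \<in> S"
    from d[OF this] show "(g has_derivative (\<lambda>h. deriv g \<zeta> * h + 0 * cnj h)) (at \<zeta>)"
      unfolding has_field_derivative_def by simp
  qed (rule d)
  moreover have "sesqui S (\<lambda>\<zeta> \<omega>. deriv g \<zeta>)"
    using holomorphic_deriv[OF left \<open>open S\<close>] by (rule sesqui.left)
  ultimately show ?case by blast
next
  case (right g)
  have "sesqui_deriv S (\<lambda>\<zeta> \<omega>. cnj (g \<omega>)) (\<lambda>\<zeta> \<omega>. 0) (\<lambda>\<zeta>. cnj (deriv g \<zeta>))"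
  proof (rule sesqui_derivI)
    fix \<zeta> assume "\<zeta> \<in> S"
    from bounded_linear.has_derivative[OF bounded_linear_cnj
        holomorphic_derivI[OF right \<open>open S\<close> this, unfolded has_field_derivative_def]]
    show "((\<lambda>x. cnj (g x)) has_derivative (\<lambda>h. 0 * h + cnj (deriv g \<zeta>) * cnj h)) (at \<zeta>)"
      by simp
  qed simp
  then show ?case using sesqui_const by blast
next
  case (add G H)
  then obtain G1 G2 H1 H2 where s: "sesqui S G1" "sesqui S H1"
    and d: "sesqui_deriv S G G1 G2" "sesqui_deriv S H H1 H2" by blast
  have "sesqui_deriv S (\<lambda>\<zeta> \<omega>. G \<zeta> \<omega> + H \<zeta> \<omega>) (\<lambda>\<zeta> \<omega>. G1 \<zeta> \<omega> + H1 \<zeta> \<omega>) (\<lambda>\<zeta>. G2 \<zeta> + H2 \<zeta>)"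
  proof (rule sesqui_derivI)
    fix \<zeta> assume "\<zeta> \<in> S"
    from has_derivative_add[OF sesqui_derivD(2)[OF d(1) this] sesqui_derivD(2)[OF d(2) this]]
    show "((\<lambda>x. G x x + H x x) has_derivative (\<lambda>h. (G1 \<zeta> \<zeta> + H1 \<zeta> \<zeta>) * h + (G2 \<zeta> + H2 \<zeta>) * cnj h)) (at \<zeta>)"
      by (simp add: algebra_simps)
  qed (intro DERIV_add sesqui_derivD(1)[OF d(1)] sesqui_derivD(1)[OF d(2)])
  then show ?case using sesqui.add[OF s] by blast
next
  case (mult G H)
  then obtain G1 G2 H1 H2 where s: "sesqui S G1" "sesqui S H1"
    and d: "sesqui_deriv S G G1 G2" "sesqui_deriv S H H1 H2" by blast
  have "sesqui_deriv S (\<lambda>\<zeta> \<omega>. G \<zeta> \<omega> * H \<zeta> \<omega>) (\<lambda>\<zeta> \<omega>. G1 \<zeta> \<omega> * H \<zeta> \<omega> + H1 \<zeta> \<omega> * G \<zeta> \<omega>)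
      (\<lambda>\<zeta>. G2 \<zeta> * H \<zeta> \<zeta> + G \<zeta> \<zeta> * H2 \<zeta>)"
  proof (rule sesqui_derivI)
    fix \<zeta> assume "\<zeta> \<in> S"
    from has_derivative_mult[OF sesqui_derivD(2)[OF d(1) this] sesqui_derivD(2)[OF d(2) this]]
    show "((\<lambda>x. G x x * H x x) has_derivative (\<lambda>h. (G1 \<zeta> \<zeta> * H \<zeta> \<zeta> + H1 \<zeta> \<zeta> * G \<zeta> \<zeta>) * h +
        (G2 \<zeta> * H \<zeta> \<zeta> + G \<zeta> \<zeta> * H2 \<zeta>) * cnj h)) (at \<zeta>)"
      by (simp add: algebra_simps)
  qed (intro DERIV_mult sesqui_derivD(1)[OF d(1)] sesqui_derivD(1)[OF d(2)])
  moreover have "sesqui S (\<lambda>\<zeta> \<omega>. G1 \<zeta> \<omega> * H \<zeta> \<omega> + H1 \<zeta> \<omega> * G \<zeta> \<omega>)"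
    using s mult.hyps by (intro sesqui.add sesqui.mult)
  ultimately show ?case by blast
qed

text \<open>A function vanishing on the diagonal has zero differential along it, so its derivative
  in the first variable vanishes on the diagonal too; then induct.\<close>

lemma sesqui_diagonal_higher_deriv:
  assumes "open S" "sesqui S G" "\<And>\<zeta>. \<zeta> \<in> S \<Longrightarrow> G \<zeta> \<zeta> = 0" "\<omega> \<in> S"
  shows "(deriv ^^ n) (\<lambda>x. G x \<omega>) \<omega> = 0"
  using assms(2,3)
proof (induction n arbitrary: G)
  case 0
  then show ?case using assms(4) by simp
next
  case (Suc n)
  obtain G1 G2 where G1: "sesqui S G1" and D: "sesqui_deriv S G G1 G2"
    using sesqui_derivative[OF Suc.prems(1) assms(1)] by blast
  note d = sesqui_derivD(1)[OF D] and dd = sesqui_derivD(2)[OF D]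
  have "G1 \<zeta> \<zeta> = 0" if "\<zeta> \<in> S" for \<zeta>
  proof -
    have "((\<lambda>x. 0) has_derivative (\<lambda>h. G1 \<zeta> \<zeta> * h + G2 \<zeta> * cnj h)) (at \<zeta>)"
      using has_derivative_transform_within_open[OF dd[OF that] assms(1) that] Suc.prems(2) by auto
    then have "(\<lambda>h. G1 \<zeta> \<zeta> * h + G2 \<zeta> * cnj h) = (\<lambda>h. 0)"
      using has_derivative_unique has_derivative_const by blast
    \<comment> \<open>The arguments 1 and \<i> separate the linear from the conjugate-linear
      coefficient.\<close>
    from fun_cong[OF this, of 1] fun_cong[OF this, of \<i>]
    have "G1 \<zeta> \<zeta> + G2 \<zeta> = 0" "\<i> * (G1 \<zeta> \<zeta> - G2 \<zeta>) = 0"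
      by (simp_all add: algebra_simps)
    then show ?thesis by (simp add: add_eq_0_iff)
  qed
  with Suc.IH[OF G1] have "(deriv ^^ n) (\<lambda>x. G1 x \<omega>) \<omega> = 0" by blast
  moreover have "(deriv ^^ n) (deriv (\<lambda>x. G x \<omega>)) \<omega> = (deriv ^^ n) (\<lambda>x. G1 x \<omega>) \<omega>"
  proof (rule higher_deriv_cong_ev)
    have "eventually (\<lambda>x. x \<in> S) (nhds \<omega>)" using assms(1,4) by (rule eventually_nhds_in_open)
    then show "\<forall>\<^sub>F x in nhds \<omega>. deriv (\<lambda>x. G x \<omega>) x = G1 x \<omega>"
      by eventually_elim (use d assms(4) in \<open>auto intro: DERIV_imp_deriv\<close>)
  qed simp
  ultimately show ?case by (simp add: funpow_Suc_right del: funpow.simps)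
qed

text \<open>With \<omega> fixed, the holomorphic function \<open>G x \<omega>\<close> of
  \<open>x\<close> has all derivatives zero at \<omega>, so the identity theorem applies.\<close>

lemma sesqui_polarisation:
  assumes "open S" "connected S" "sesqui S G" "\<And>\<zeta>. \<zeta> \<in> S \<Longrightarrow> G \<zeta> \<zeta> = 0" "\<zeta> \<in> S" "\<omega> \<in> S"
  shows "G \<zeta> \<omega> = 0"
proof (rule holomorphic_fun_eq_0_on_connected[of "\<lambda>x. G x \<omega>" S \<omega> \<zeta>])
  show "(\<lambda>x. G x \<omega>) holomorphic_on S"
    using sesqui_derivative[OF assms(3,1)] assms(6) sesqui_derivD(1)
    unfolding holomorphic_on_open[OF assms(1)] by blast
  show "(deriv ^^ n) (\<lambda>x. G x \<omega>) \<omega> = 0" for n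
    using sesqui_diagonal_higher_deriv[OF assms(1,3,4,6)] .
qed (use assms in auto)

section \<open>The Bergman metrics\<close>

definition herm :: "complex ^ 'k \<Rightarrow> complex ^ 'k \<Rightarrow> complex" where
  "herm x y = (\<Sum>i\<in>UNIV. x $ i * cnj (y $ i))"

definition bil :: "complex ^ 'k \<Rightarrow> complex ^ 'k \<Rightarrow> complex" where
  "bil x y = (\<Sum>i\<in>UNIV. x $ i * y $ i)"

text \<open>Extension of \<open>QIV\<close> off the diagonal, holomorphic in \<open>x\<close> and
  antiholomorphic in \<open>y\<close>: its power with exponent \<open>- CARD('m)\<close> is the
  Bergman kernel up to a constant.\<close>

definition QIV_polar :: "complex ^ 'm \<Rightarrow> complex ^ 'm \<Rightarrow> complex" where
  "QIV_polar x y = 1 - herm x y + bilin_sq x * cnj (bilin_sq y) / 4"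

lemma herm_self: "herm x x = of_real (sqnorm x)"
  by (simp add: herm_def sqnorm_def complex_norm_square del: of_real_power)

lemma bilin_sq_eq_bil: "bilin_sq x = bil x x"
  by (simp add: bilin_sq_def bil_def power2_eq_square)

lemma QIV_polar_self: "QIV_polar x x = of_real (QIV x)"
  by (simp add: QIV_polar_def QIV_def herm_self complex_norm_square del: of_real_power)

lemma herm_commute: "herm y x = cnj (herm x y)"
  by (simp add: herm_def mult.commute)

lemma bil_commute: "bil y x = bil x y"
  by (simp add: bil_def mult.commute)

lemma herm_add_left: "herm (x + y) z = herm x z + herm y z"
  and herm_add_right: "herm z (x + y) = herm z x + herm z y"
  and herm_diff_left: "herm (x - y) z = herm x z - herm y z"
  and herm_diff_right: "herm z (x - y) = herm z x - herm z y"
  and herm_scale_left: "herm (c *s x) z = c * herm x z"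
  and herm_scale_right: "herm z (c *s x) = cnj c * herm z x"
  and herm_scaleR_left: "herm (t *\<^sub>R x) z = of_real t * herm x z"
  and herm_scaleR_right: "herm z (t *\<^sub>R x) = of_real t * herm z x"
  and herm_zero_left: "herm 0 z = 0"
  and herm_zero_right: "herm z 0 = 0"
  by (simp_all add: herm_def distrib_left distrib_right sum.distrib left_diff_distrib right_diff_distrib
      sum_subtractf sum_distrib_left mult_ac scaleR_conv_of_real[where 'a = complex])

lemmas herm_simps = herm_add_left herm_add_right herm_diff_left herm_diff_right herm_scale_left
  herm_scale_right herm_scaleR_left herm_scaleR_right herm_zero_left herm_zero_right

lemma bil_add_left: "bil (x + y) z = bil x z + bil y z"
  and bil_add_right: "bil z (x + y) = bil z x + bil z y"
  and bil_scale_left: "bil (c *s x) z = c * bil x z"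
  and bil_scale_right: "bil z (c *s x) = c * bil z x"
  and bil_scaleR_left: "bil (t *\<^sub>R x) z = of_real t * bil x z"
  and bil_scaleR_right: "bil z (t *\<^sub>R x) = of_real t * bil z x"
  and bil_zero_left: "bil 0 z = 0"
  and bil_zero_right: "bil z 0 = 0"
  by (simp_all add: bil_def distrib_left distrib_right sum.distrib
      sum_distrib_left mult_ac scaleR_conv_of_real[where 'a = complex])

lemmas bil_simps = bil_add_left bil_add_right bil_scale_left bil_scale_right bil_scaleR_left
  bil_scaleR_right bil_zero_left bil_zero_right

lemma sqnorm_eq_0_iff: "sqnorm x = 0 \<longleftrightarrow> x = 0"
  by (auto simp: sqnorm_def sum_nonneg_eq_0_iff vec_eq_iff)

lemma sqnorm_eq_Re_herm: "sqnorm x = Re (herm x x)"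
  by (simp add: herm_self)

text \<open>On a real line both log kernels are logarithms of polynomials in the parameter, so their
  second derivatives at 0 involve only the first three coefficients.\<close>

lemma deriv2_ln_poly:
  fixes p :: "real poly"
  assumes g: "\<And>t. g t = c * ln (poly p t)" and pos: "poly p 0 > 0"
  shows "deriv (deriv g) 0 = c * (2 * coeff p 2 * coeff p 0 - (coeff p 1)\<^sup>2) / (coeff p 0)\<^sup>2"
proof -
  have "open {t. poly p t > 0}"
    by (intro open_Collect_less continuous_intros)
  then have ev: "eventually (\<lambda>t. poly p t > 0) (nhds 0)"
    using pos eventually_nhds_in_open[of "{t. poly p t > 0}" 0] by simp
  have d: "deriv g t = c * (poly (pderiv p) t / poly p t)" if "poly p t > 0" for t
  proof -
    have "(g has_real_derivative c * (poly (pderiv p) t / poly p t)) (at t)"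
      unfolding g[abs_def] using that by (auto intro!: derivative_eq_intros)
    then show ?thesis by (rule DERIV_imp_deriv)
  qed
  have "deriv (deriv g) 0 = deriv (\<lambda>t. c * (poly (pderiv p) t / poly p t)) 0"
    using ev by (intro deriv_cong_ev) (auto elim!: eventually_mono simp: d)
  also have "\<dots> = c * ((poly (pderiv (pderiv p)) 0 * poly p 0 - poly (pderiv p) 0 * poly (pderiv p) 0) /
      (poly p 0 * poly p 0))"
    using pos by (intro DERIV_imp_deriv) (auto intro!: derivative_eq_intros simp: algebra_simps)
  also have "\<dots> = c * (2 * coeff p 2 * coeff p 0 - (coeff p 1)\<^sup>2) / (coeff p 0)\<^sup>2"
    by (simp add: poly_0_coeff_0 coeff_pderiv power2_eq_square numeral_2_eq_2)
  finally show ?thesis .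
qed

lemma sqnorm_line: "sqnorm (W + t *\<^sub>R V) = sqnorm W + 2 * t * Re (herm V W) + t\<^sup>2 * sqnorm V"
  by (simp add: sqnorm_eq_Re_herm herm_simps herm_commute[of W V] algebra_simps power2_eq_square)

lemma bilin_sq_line: "bilin_sq (W + t *\<^sub>R V) = bilin_sq W + 2 * of_real t * bil W V + (of_real t)\<^sup>2 * bilin_sq V"
  by (simp add: bilin_sq_eq_bil bil_simps bil_commute[of V W] algebra_simps power2_eq_square)

lemma cmod_sq_quadratic:
  "(cmod (x + 2 * of_real t * y + (of_real t)\<^sup>2 * w))\<^sup>2 =
    (cmod x)\<^sup>2 + 4 * t * Re (y * cnj x) + t\<^sup>2 * (4 * (cmod y)\<^sup>2 + 2 * Re (w * cnj x))
      + 4 * t ^ 3 * Re (w * cnj y) + t ^ 4 * (cmod w)\<^sup>2"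
  unfolding cmod_power2 by (simp add: power2_eq_square algebra_simps power3_eq_cube power4_eq_xxxx)

lemma QIV_line:
  "QIV (W + t *\<^sub>R V) = poly [:QIV W, - 2 * Re (herm V W) + Re (bil W V * cnj (bilin_sq W)),
     - sqnorm V + (cmod (bil W V))\<^sup>2 + Re (bilin_sq V * cnj (bilin_sq W)) / 2,
     Re (bilin_sq V * cnj (bil W V)), (cmod (bilin_sq V))\<^sup>2 / 4:] t"
  unfolding QIV_def sqnorm_line bilin_sq_line cmod_sq_quadratic
  by (simp add: algebra_simps power2_eq_square power3_eq_cube power4_eq_xxxx)

lemma average_quotient:
  fixes A B C c d :: real
  assumes "A + B = 4 * C"
  shows "(c * A / d + c * B / d) / 4 = c * C / d"
proof -
  have "(c * A / d + c * B / d) / 4 = c * (A + B) / d / 4" by (simp add: distrib_left add_divide_distrib)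
  then show ?thesis by (simp add: assms)
qed

lemma levi_form_logK_IV:
  fixes W V :: "complex ^ 'm"
  assumes "QIV W > 0"
  shows "levi_form logK_IV W V = - real CARD('m) *
    (QIV W * ((cmod (bil W V))\<^sup>2 - sqnorm V) - (cmod (bil W V * cnj (bilin_sq W) / 2 - herm V W))\<^sup>2) / (QIV W)\<^sup>2"
proof -
  have d: "deriv (deriv (\<lambda>t. logK_IV (W + t *\<^sub>R V))) 0 = - real CARD('m) *
      (2 * (- sqnorm V + (cmod (bil W V))\<^sup>2 + Re (bilin_sq V * cnj (bilin_sq W)) / 2) * QIV W
        - (- 2 * Re (herm V W) + Re (bil W V * cnj (bilin_sq W)))\<^sup>2) / (QIV W)\<^sup>2" for V
    by (subst deriv2_ln_poly[where c = "- real CARD('m)"], unfold logK_IV_def QIV_line, rule refl)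
      (use assms in \<open>simp_all add: numeral_2_eq_2\<close>)
  have i: "sqnorm (\<i> *s V) = sqnorm V" "bilin_sq (\<i> *s V) = - bilin_sq V"
    by (simp_all add: sqnorm_scale bilin_sq_eq_bil bil_simps)
  show ?thesis
    unfolding levi_form_def d i herm_simps bil_simps mult.assoc[of \<i>] norm_mult
  proof -
    define x h where "x = bil W V * cnj (bilin_sq W)" and "h = herm V W"
    define N b r where "N = sqnorm V" and "b = (cmod (bil W V))\<^sup>2" and "r = Re (bilin_sq V * cnj (bilin_sq W))"
    have r': "Re (- bilin_sq V * cnj (bilin_sq W)) = - r" by (simp add: r_def)
    have "(2 * (- N + b + r / 2) * QIV W - (- 2 * Re h + Re x)\<^sup>2) +
        (2 * (- N + b + - r / 2) * QIV W - (- 2 * Re (\<i> * h) + Re (\<i> * x))\<^sup>2) =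
        4 * (QIV W * (b - N) - (cmod (x / 2 - h))\<^sup>2)"
      unfolding cmod_power2 by (simp add: power2_eq_square algebra_simps)
    then show "(- real CARD('m) * (2 * (- sqnorm V + (cmod (bil W V))\<^sup>2 +
          Re (bilin_sq V * cnj (bilin_sq W)) / 2) * QIV W -
          (- 2 * Re (herm V W) + Re (bil W V * cnj (bilin_sq W)))\<^sup>2) / (QIV W)\<^sup>2 +
        - real CARD('m) * (2 * (- sqnorm V + (cmod \<i> * cmod (bil W V))\<^sup>2 +
          Re (- bilin_sq V * cnj (bilin_sq W)) / 2) * QIV W -
          (- 2 * Re (\<i> * herm V W) + Re (\<i> * (bil W V * cnj (bilin_sq W))))\<^sup>2) / (QIV W)\<^sup>2) / 4 =
        - real CARD('m) * (QIV W * ((cmod (bil W V))\<^sup>2 - sqnorm V) -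
          (cmod (bil W V * cnj (bilin_sq W) / 2 - herm V W))\<^sup>2) / (QIV W)\<^sup>2"
      unfolding r' norm_ii mult_1 x_def h_def N_def b_def r_def by (rule average_quotient)
  qed
qed

lemma levi_form_logK_ball:
  fixes z v :: "complex ^ 'n"
  assumes "sqnorm z < 1"
  shows "levi_form logK_ball z v = real (CARD('n) + 1) *
    ((1 - sqnorm z) * sqnorm v + (cmod (herm v z))\<^sup>2) / (1 - sqnorm z)\<^sup>2"
proof -
  have l: "1 - sqnorm (z + t *\<^sub>R v) = poly [:1 - sqnorm z, - 2 * Re (herm v z), - sqnorm v:] t" for t v
    by (simp add: sqnorm_line algebra_simps power2_eq_square)
  have d: "deriv (deriv (\<lambda>t. logK_ball (z + t *\<^sub>R v))) 0 = - real (CARD('n) + 1) *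
      (2 * (- sqnorm v) * (1 - sqnorm z) - (- 2 * Re (herm v z))\<^sup>2) / (1 - sqnorm z)\<^sup>2" for v
    by (subst deriv2_ln_poly[where c = "- real (CARD('n) + 1)"], unfold logK_ball_def l, rule refl)
      (use assms in \<open>simp_all add: numeral_2_eq_2\<close>)
  have i: "sqnorm (\<i> *s v) = sqnorm v"
    by (simp add: sqnorm_scale)
  show ?thesis
    unfolding levi_form_def d i herm_simps
    by (subst average_quotient[where C = "- ((1 - sqnorm z) * sqnorm v + (cmod (herm v z))\<^sup>2)"])
      (simp_all add: cmod_power2 power_mult_distrib algebra_simps)
qed

section \<open>The functional equation\<close>

definition vec_holomorphic_on :: "complex set \<Rightarrow> (complex \<Rightarrow> complex ^ 'k) \<Rightarrow> bool" where
  "vec_holomorphic_on S a \<longleftrightarrow> (\<forall>i. (\<lambda>\<zeta>. a \<zeta> $ i) holomorphic_on S)"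

lemma holomorphic_bil:
  "vec_holomorphic_on S a \<Longrightarrow> vec_holomorphic_on S b \<Longrightarrow> (\<lambda>\<zeta>. bil (a \<zeta>) (b \<zeta>)) holomorphic_on S"
  unfolding bil_def vec_holomorphic_on_def by (intro holomorphic_intros) auto

lemma holomorphic_bilin_sq:
  "vec_holomorphic_on S a \<Longrightarrow> (\<lambda>\<zeta>. bilin_sq (a \<zeta>)) holomorphic_on S"
  unfolding bilin_sq_eq_bil by (intro holomorphic_bil)

lemma sesqui_herm:
  "vec_holomorphic_on S a \<Longrightarrow> vec_holomorphic_on S b \<Longrightarrow> sesqui S (\<lambda>\<zeta> \<omega>. herm (a \<zeta>) (b \<omega>))"
  unfolding herm_def vec_holomorphic_on_def
  by (intro sesqui_sum sesqui.mult sesqui.left[of "\<lambda>\<zeta>. a \<zeta> $ _"] sesqui.right[of "\<lambda>\<zeta>. b \<zeta> $ _"]) auto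

lemma sesqui_QIV_polar:
  assumes "vec_holomorphic_on S a" "vec_holomorphic_on S b"
  shows "sesqui S (\<lambda>\<zeta> \<omega>. QIV_polar (a \<zeta>) (b \<omega>))"
  unfolding QIV_polar_def
  by (intro sesqui.add sesqui_diff sesqui.mult sesqui_divide sesqui_const sesqui_herm assms
      sesqui.left[OF holomorphic_bilin_sq] sesqui.right[OF holomorphic_bilin_sq])

lemma sqnorm_eq_norm: "sqnorm z = (norm z)\<^sup>2"
  by (simp add: sqnorm_def norm_vec_def L2_set_def sum_nonneg)

lemma linear_smult_line: "bounded_linear (\<lambda>h::complex. h *s (v :: complex ^ 'k))"
  unfolding linear_conv_bounded_linear[symmetric]
  by (rule linearI) (simp_all add: vec_eq_iff algebra_simps)

text \<open>Slices of balls by complex lines are the domains on which polarisation and integration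
  take place; convexity supplies connectedness.\<close>

lemma line_domain:
  fixes x v :: "complex ^ 'k"
  defines "S r \<equiv> {\<zeta>. sqnorm (x + \<zeta> *s v) < r}"
  assumes "r > 0"
  shows "open (S r)" "convex (S r)"
proof -
  have S: "S r = {\<zeta>. norm (x + \<zeta> *s v) < sqrt r}"
    using assms(2) unfolding S_def sqnorm_eq_norm
    by (metis norm_ge_zero real_sqrt_abs abs_norm_cancel real_sqrt_less_iff)
  have "continuous_on UNIV (\<lambda>\<zeta>. x + \<zeta> *s v)"
    by (intro continuous_intros linear_continuous_on linear_smult_line)
  then show "open (S r)"
    unfolding S by (intro open_Collect_less continuous_on_norm continuous_on_const)
  show "convex (S r)"
  proof (rule convexI)
    fix a b :: complex and s t :: real
    assume *: "a \<in> S r" "b \<in> S r" "0 \<le> s" "0 \<le> t" "s + t = 1"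
    have "x + (s *\<^sub>R a + t *\<^sub>R b) *s v = (s + t) *\<^sub>R x + (s *\<^sub>R a + t *\<^sub>R b) *s v"
      using * by simp
    also have "\<dots> = s *\<^sub>R (x + a *s v) + t *\<^sub>R (x + b *s v)"
      by (simp add: vec_eq_iff algebra_simps)
    finally have "x + (s *\<^sub>R a + t *\<^sub>R b) *s v = s *\<^sub>R (x + a *s v) + t *\<^sub>R (x + b *s v)" .
    moreover have "s *\<^sub>R (x + a *s v) + t *\<^sub>R (x + b *s v) \<in> ball 0 (sqrt r)"
      using * by (intro convexD[OF convex_ball]) (auto simp: S)
    ultimately show "s *\<^sub>R a + t *\<^sub>R b \<in> S r"
      by (simp add: S)
  qed
qed

lemma vec_holomorphic_affine: "vec_holomorphic_on S (\<lambda>\<zeta>. x + \<zeta> *s v)"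
  unfolding vec_holomorphic_on_def vector_add_component vector_smult_component
  by (intro allI holomorphic_intros)

lemma has_field_derivative_zero_imp_const:
  fixes f :: "complex \<Rightarrow> complex"
  assumes "convex T" "\<And>x. x \<in> T \<Longrightarrow> (f has_field_derivative 0) (at x)" "x \<in> T" "y \<in> T"
  shows "f x = f y"
  using has_field_derivative_zero_constant[of T f] assms
  by (metis has_field_derivative_at_within)

section \<open>The Levi identity along radii and its first integration\<close>

locale IV_isometry =
  fixes F :: "complex ^ 'n \<Rightarrow> complex ^ 'm" and lam :: real
  assumes hol: "holomorphic_map_on unit_ball_C F"
    and maps: "F ` unit_ball_C \<subseteq> type_IV_domain"
    and lam_pos: "lam > 0"
    and isom: "\<And>z v. z \<in> unit_ball_C \<Longrightarrow>
      levi_form logK_IV (F z) (frechet_derivative F (at z) v) = lam * levi_form logK_ball z v"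
    and F_zero: "F 0 = 0"
begin

text \<open>The exponent in \<open>QIV_polar (F z) (F w) = (1 - herm z w) ^ \<mu>\<close>: the
  isometry constant corrected by the exponents of the two Bergman kernels.\<close>

definition \<mu> :: real where
  "\<mu> = lam * real (CARD('n) + 1) / real CARD('m)"

definition dF :: "complex ^ 'n \<Rightarrow> complex ^ 'n \<Rightarrow> complex ^ 'm" where
  "dF z = frechet_derivative F (at z)"

lemma \<mu>_pos: "\<mu> > 0"
  unfolding \<mu>_def using lam_pos by (intro divide_pos_pos mult_pos_pos) auto

lemma F_has_derivative:
  assumes "sqnorm z < 1"
  shows "(F has_derivative dF z) (at z)" "dF z (c *s v) = c *s dF z v"
proof -
  obtain L where L: "(F has_derivative L) (at z)" "\<And>c v. L (c *s v) = c *s L v"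
    using hol assms unfolding holomorphic_map_on_def unit_ball_C_def by blast
  then have "dF z = L"
    unfolding dF_def by (metis frechet_derivative_at)
  then show "(F has_derivative dF z) (at z)" "dF z (c *s v) = c *s dF z v"
    using L by simp_all
qed

lemma F_line_derivative:
  assumes "sqnorm (x + \<zeta> *s v) < 1"
  shows "((\<lambda>\<zeta>. F (x + \<zeta> *s v) $ j) has_field_derivative dF (x + \<zeta> *s v) v $ j) (at \<zeta>)"
proof -
  have "((\<lambda>\<zeta>. x + \<zeta> *s v) has_derivative (\<lambda>h. h *s v)) (at \<zeta>)"
    by (auto intro!: derivative_eq_intros bounded_linear_imp_has_derivative[OF linear_smult_line])
  then have "((\<lambda>\<zeta>. F (x + \<zeta> *s v)) has_derivative (\<lambda>h. dF (x + \<zeta> *s v) (h *s v))) (at \<zeta>)"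
    using F_has_derivative(1)[OF assms] by (rule has_derivative_compose)
  then have "((\<lambda>\<zeta>. F (x + \<zeta> *s v) $ j) has_derivative (\<lambda>h. dF (x + \<zeta> *s v) (h *s v) $ j)) (at \<zeta>)"
    by (rule bounded_linear.has_derivative[OF bounded_linear_vec_nth])
  moreover have "(\<lambda>h. dF (x + \<zeta> *s v) (h *s v) $ j) = (*) (dF (x + \<zeta> *s v) v $ j)"
    by (auto simp: F_has_derivative(2)[OF assms] fun_eq_iff)
  ultimately show ?thesis
    by (simp add: has_field_derivative_def)
qed

lemma F_line_holomorphic:
  assumes "r \<le> 1" 
  shows "vec_holomorphic_on {\<zeta>. sqnorm (x + \<zeta> *s v) < r} (\<lambda>\<zeta>. F (x + \<zeta> *s v))"
  unfolding vec_holomorphic_on_def holomorphic_on_def field_differentiable_def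
proof (intro allI ballI exI)
  fix j \<zeta> assume "\<zeta> \<in> {\<zeta>. sqnorm (x + \<zeta> *s v) < r}"
  then have "sqnorm (x + \<zeta> *s v) < 1" using assms by simp
  then show "((\<lambda>\<zeta>. F (x + \<zeta> *s v) $ j) has_field_derivative dF (x + \<zeta> *s v) v $ j)
      (at \<zeta> within {\<zeta>. sqnorm (x + \<zeta> *s v) < r})"
    by (rule has_field_derivative_at_within[OF F_line_derivative])
qed

lemma dF_line_holomorphic:
  assumes "0 < r" "r \<le> 1"
  shows "vec_holomorphic_on {\<zeta>. sqnorm (x + \<zeta> *s v) < r} (\<lambda>\<zeta>. dF (x + \<zeta> *s v) v)"
  unfolding vec_holomorphic_on_def
proof
  fix i
  let ?S = "{\<zeta>. sqnorm (x + \<zeta> *s v) < r}"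
  have "deriv (\<lambda>\<zeta>. F (x + \<zeta> *s v) $ i) holomorphic_on ?S"
    using F_line_holomorphic[OF assms(2), of x v] line_domain(1)[OF assms(1), of x v]
    unfolding vec_holomorphic_on_def by (intro holomorphic_deriv) auto
  moreover have "deriv (\<lambda>\<zeta>. F (x + \<zeta> *s v) $ i) \<zeta> = dF (x + \<zeta> *s v) v $ i" if "\<zeta> \<in> ?S" for \<zeta>
    using that assms(2) by (intro DERIV_imp_deriv[OF F_line_derivative]) auto
  ultimately show "(\<lambda>\<zeta>. dF (x + \<zeta> *s v) v $ i) holomorphic_on ?S"
    by (rule holomorphic_transform)
qed

lemma QIV_F_pos: "sqnorm z < 1 \<Longrightarrow> QIV (F z) > 0"
  using maps unfolding unit_ball_C_def type_IV_domain_def by blast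

text \<open>In the radial direction the numerator of the Levi form of the ball collapses to
  \<open>sqnorm v\<close>. Denominators are cleared so that both sides are diagonal values of
  functions to which polarisation applies.\<close>

lemma levi_identity_radial:
  assumes "sqnorm (\<zeta> *s v) < 1"
  defines "W \<equiv> F (\<zeta> *s v)" and "V \<equiv> dF (\<zeta> *s v) v"
  shows "(1 - sqnorm (\<zeta> *s v))\<^sup>2 * (QIV W * ((cmod (bil W V))\<^sup>2 - sqnorm V)
      - (cmod (bil W V * cnj (bilin_sq W) / 2 - herm V W))\<^sup>2) = - \<mu> * sqnorm v * (QIV W)\<^sup>2"
proof -
  have Q: "QIV W > 0" unfolding W_def by (rule QIV_F_pos[OF assms(1)])
  have "herm v (\<zeta> *s v) = cnj \<zeta> * of_real (sqnorm v)"
    by (simp add: herm_simps herm_self)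
  then have "(1 - sqnorm (\<zeta> *s v)) * sqnorm v + (cmod (herm v (\<zeta> *s v)))\<^sup>2 = sqnorm v"
    by (simp add: norm_mult sqnorm_scale power_mult_distrib algebra_simps power2_eq_square)
  then have ball: "levi_form logK_ball (\<zeta> *s v) v = real (CARD('n) + 1) * sqnorm v / (1 - sqnorm (\<zeta> *s v))\<^sup>2"
    using levi_form_logK_ball[OF assms(1), of v] by (simp only:)
  define X where "X = QIV W * ((cmod (bil W V))\<^sup>2 - sqnorm V) - (cmod (bil W V * cnj (bilin_sq W) / 2 - herm V W))\<^sup>2"
  have "levi_form logK_IV W V = lam * levi_form logK_ball (\<zeta> *s v) v"
    using isom[of "\<zeta> *s v" v] assms(1) unfolding unit_ball_C_def V_def W_def dF_def by simp
  then have eq: "- real CARD('m) * X / (QIV W)\<^sup>2 = lam * real (CARD('n) + 1) * sqnorm v / (1 - sqnorm (\<zeta> *s v))\<^sup>2"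
    unfolding ball levi_form_logK_IV[OF Q] X_def times_divide_eq_right mult.assoc .
  have nz: "(QIV W)\<^sup>2 \<noteq> 0" "(1 - sqnorm (\<zeta> *s v))\<^sup>2 \<noteq> 0" using Q assms(1) by simp_all
  have "- real CARD('m) * X * (1 - sqnorm (\<zeta> *s v))\<^sup>2 = lam * real (CARD('n) + 1) * sqnorm v * (QIV W)\<^sup>2"
    by (rule iffD1[OF frac_eq_eq[OF nz] eq])
  also have "lam * real (CARD('n) + 1) = \<mu> * real CARD('m)" by (simp add: \<mu>_def)
  finally have "real CARD('m) * ((1 - sqnorm (\<zeta> *s v))\<^sup>2 * X + \<mu> * sqnorm v * (QIV W)\<^sup>2) = 0"
    by (simp add: algebra_simps)
  then have "(1 - sqnorm (\<zeta> *s v))\<^sup>2 * X + \<mu> * sqnorm v * (QIV W)\<^sup>2 = 0" by simp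
  then show ?thesis unfolding X_def by linarith
qed

end

context IV_isometry
begin

lemma radial_polar_identity:
  assumes "sqnorm (\<zeta> *s v) < 1" "sqnorm (\<omega> *s v) < 1"
  defines "W \<equiv> F (\<zeta> *s v)" and "V \<equiv> dF (\<zeta> *s v) v" and "X \<equiv> F (\<omega> *s v)" and "U \<equiv> dF (\<omega> *s v) v"
  shows "(1 - \<zeta> * cnj \<omega> * of_real (sqnorm v))\<^sup>2 * (QIV_polar W X * (bil W V * cnj (bil X U) - herm V U)
      - (bil W V * cnj (bilin_sq X) / 2 - herm V X) * (bilin_sq W * cnj (bil X U) / 2 - herm W U))
      + of_real (\<mu> * sqnorm v) * (QIV_polar W X)\<^sup>2 = 0"
proof -
  let ?S = "{\<zeta>. sqnorm (\<zeta> *s v) < 1}"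
  let ?F = "\<lambda>\<zeta>. F (\<zeta> *s v)" and ?V = "\<lambda>\<zeta>. dF (\<zeta> *s v) v"
  have hF: "vec_holomorphic_on ?S ?F"
    using F_line_holomorphic[of 1 0 v] by simp
  have hV: "vec_holomorphic_on ?S ?V"
    using dF_line_holomorphic[of 1 0 v] by simp
  \<comment> \<open>Each squared modulus of the diagonal identity is split into a factor in \<zeta>
    and a conjugate factor in \<omega>.\<close>
  define G where "G \<zeta> \<omega> = (1 - \<zeta> * cnj \<omega> * of_real (sqnorm v))\<^sup>2 *
      (QIV_polar (?F \<zeta>) (?F \<omega>) * (bil (?F \<zeta>) (?V \<zeta>) * cnj (bil (?F \<omega>) (?V \<omega>)) - herm (?V \<zeta>) (?V \<omega>))
      - (bil (?F \<zeta>) (?V \<zeta>) * cnj (bilin_sq (?F \<omega>)) / 2 - herm (?V \<zeta>) (?F \<omega>)) *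
        (bilin_sq (?F \<zeta>) * cnj (bil (?F \<omega>) (?V \<omega>)) / 2 - herm (?F \<zeta>) (?V \<omega>)))
      + of_real (\<mu> * sqnorm v) * (QIV_polar (?F \<zeta>) (?F \<omega>))\<^sup>2" for \<zeta> \<omega>
  have id: "sesqui ?S (\<lambda>\<zeta> \<omega>. \<zeta>)" "sesqui ?S (\<lambda>\<zeta> \<omega>. cnj \<omega>)"
    using sesqui.left[of "\<lambda>\<zeta>. \<zeta>" ?S] sesqui.right[of "\<lambda>\<zeta>. \<zeta>" ?S] by simp_all
  note l = sesqui.left[OF holomorphic_bil[OF hF hV]] sesqui.left[OF holomorphic_bilin_sq[OF hF]]
    sesqui.right[OF holomorphic_bil[OF hF hV]] sesqui.right[OF holomorphic_bilin_sq[OF hF]]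
    sesqui_herm[OF hF hF] sesqui_herm[OF hF hV] sesqui_herm[OF hV hF] sesqui_herm[OF hV hV]
    sesqui_QIV_polar[OF hF hF]
  have "sesqui ?S G"
    unfolding G_def[abs_def]
    by (intro sesqui.add sesqui.mult sesqui_power sesqui_diff sesqui_divide l id sesqui_const)
  moreover have "G \<zeta> \<zeta> = 0" if "\<zeta> \<in> ?S" for \<zeta>
  proof -
    define W V where "W = ?F \<zeta>" and "V = ?V \<zeta>"
    define b where "b = bil W V * cnj (bilin_sq W) / 2 - herm V W"
    have p: "\<zeta> * cnj \<zeta> * of_real (sqnorm v) = of_real (sqnorm (\<zeta> *s v))"
      unfolding sqnorm_scale of_real_mult complex_norm_square ..
    have c: "bilin_sq W * cnj (bil W V) / 2 - herm W V = cnj b"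
      by (simp add: b_def herm_commute[of W V] mult.commute)
    have "G \<zeta> \<zeta> = of_real ((1 - sqnorm (\<zeta> *s v))\<^sup>2 * (QIV W * ((cmod (bil W V))\<^sup>2 - sqnorm V)
        - (cmod b)\<^sup>2) + \<mu> * sqnorm v * (QIV W)\<^sup>2)"
      unfolding G_def W_def[symmetric] V_def[symmetric] b_def[symmetric] c QIV_polar_self herm_self p
      unfolding complex_norm_square[symmetric] by simp
    also have "\<dots> = 0"
      using levi_identity_radial[of \<zeta> v] that unfolding W_def V_def b_def by simp
    finally show ?thesis .
  qed
  moreover have "open ?S" "connected ?S"
    using line_domain[of 1 0 v] by (simp_all add: convex_connected)
  ultimately have "G \<zeta> \<omega> = 0"
    using sesqui_polarisation[of ?S G \<zeta> \<omega>] assms(1,2) by blast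
  then show ?thesis
    unfolding G_def W_def V_def X_def U_def .
qed

text \<open>Positivity of \<open>QIV\<close> covers only the diagonal. Off it, continuity and the
  value 1 at the origin give a ball where division by the kernel is possible.\<close>

lemma QIV_polar_nonzero_near_0:
  obtains \<rho> where "0 < \<rho>" "\<rho> \<le> 1"
    "\<And>z w. sqnorm z < \<rho> \<Longrightarrow> sqnorm w < \<rho> \<Longrightarrow> QIV_polar (F z) (F w) \<noteq> 0"
proof -
  have "continuous_on UNIV (\<lambda>p :: (complex ^ 'm) \<times> (complex ^ 'm). QIV_polar (fst p) (snd p))"
    unfolding QIV_polar_def herm_def bilin_sq_def by (intro continuous_intros) auto
  then have "isCont (\<lambda>p :: (complex ^ 'm) \<times> (complex ^ 'm). QIV_polar (fst p) (snd p)) 0"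
    unfolding continuous_on_eq_continuous_at[OF open_UNIV] by blast
  moreover have "QIV_polar (fst (0 :: (complex ^ 'm) \<times> (complex ^ 'm))) (snd 0) = 1"
    by (simp add: QIV_polar_def herm_def bilin_sq_def)
  ultimately obtain e where e: "e > 0"
    "\<And>p :: (complex ^ 'm) \<times> (complex ^ 'm). dist p 0 < e \<Longrightarrow> dist (QIV_polar (fst p) (snd p)) 1 < 1"
    unfolding continuous_at_eps_delta using zero_less_one[where 'a = real] by metis
  have "isCont F 0"
    using F_has_derivative(1)[of 0] has_derivative_continuous[of F] by (simp add: sqnorm_def)
  then obtain d where d: "d > 0" "\<And>z. norm z < d \<Longrightarrow> norm (F z) < e / 2"
    unfolding continuous_at_eps_delta using half_gt_zero[OF e(1)] F_zero by (metis dist_0_norm dist_commute)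
  \<comment> \<open>\<open>d\<close> is squared because \<open>sqnorm\<close> is the squared norm;
    the minimum with 1 stays inside the unit ball.\<close>
  define \<rho> where "\<rho> = min 1 (d\<^sup>2)"
  have small: "norm (F z) < e / 2" if "sqnorm z < \<rho>" for z :: "complex ^ 'n"
  proof -
    have "(norm z)\<^sup>2 < d\<^sup>2" using that by (simp add: \<rho>_def sqnorm_eq_norm)
    then show ?thesis using d power_less_imp_less_base[of "norm z" 2 d] by simp
  qed
  show ?thesis
  proof
    show "0 < \<rho>" "\<rho> \<le> 1" using d(1) by (simp_all add: \<rho>_def)
    fix z w :: "complex ^ 'n" assume "sqnorm z < \<rho>" "sqnorm w < \<rho>"
    then have "norm (F z, F w) < e"
      using norm_Pair_le[of "F z" "F w"] small[of z] small[of w] by linarith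
    then have "dist (QIV_polar (F z) (F w)) 1 < 1"
      using e(2)[of "(F z, F w)"] by simp
    then show "QIV_polar (F z) (F w) \<noteq> 0" by (auto simp: dist_norm)
  qed
qed

lemma radial_derivatives:
  assumes "sqnorm (\<zeta> *s v) < 1"
  defines "W \<equiv> F (\<zeta> *s v)" and "V \<equiv> dF (\<zeta> *s v) v"
  shows "((\<lambda>\<zeta>. herm (F (\<zeta> *s v)) Y) has_field_derivative herm V Y) (at \<zeta>)"
    and "((\<lambda>\<zeta>. bilin_sq (F (\<zeta> *s v))) has_field_derivative 2 * bil W V) (at \<zeta>)"
    and "((\<lambda>\<zeta>. QIV_polar (F (\<zeta> *s v)) Y) has_field_derivative bil W V * cnj (bilin_sq Y) / 2 - herm V Y) (at \<zeta>)"
proof -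
  have d: "((\<lambda>\<zeta>. F (\<zeta> *s v) $ j) has_field_derivative V $ j) (at \<zeta>)" for j
    using F_line_derivative[of 0 \<zeta> v j] assms(1) by (simp add: V_def)
  show h: "((\<lambda>\<zeta>. herm (F (\<zeta> *s v)) Y) has_field_derivative herm V Y) (at \<zeta>)"
    unfolding herm_def by (auto intro!: derivative_eq_intros d)
  show b: "((\<lambda>\<zeta>. bilin_sq (F (\<zeta> *s v))) has_field_derivative 2 * bil W V) (at \<zeta>)"
    unfolding bilin_sq_def bil_def sum_distrib_left
    by (auto intro!: derivative_eq_intros d sum.cong simp: W_def)
  show "((\<lambda>\<zeta>. QIV_polar (F (\<zeta> *s v)) Y) has_field_derivative bil W V * cnj (bilin_sq Y) / 2 - herm V Y) (at \<zeta>)"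
    unfolding QIV_polar_def by (auto intro!: derivative_eq_intros h b)
qed

text \<open>The squared modulus of the subtracted term is
  \<open>sqnorm (\<zeta> *s v) * sqnorm (\<omega> *s v)\<close>, which is below 1.\<close>

lemma radial_kernel_nonzero:
  assumes "sqnorm (\<zeta> *s v) < 1" "sqnorm (\<omega> *s v) < 1"
  shows "1 - \<zeta> * cnj \<omega> * of_real (sqnorm v) \<noteq> 0"
proof
  assume "1 - \<zeta> * cnj \<omega> * of_real (sqnorm v) = 0"
  then have "cmod (\<zeta> * cnj \<omega> * of_real (sqnorm v)) = 1"
    by (metis eq_iff_diff_eq_0 norm_one)
  then have "cmod \<zeta> * cmod \<omega> * sqnorm v = 1"
    using sqnorm_nonneg[of v] by (simp add: norm_mult)
  then have "1 = (cmod \<zeta> * cmod \<omega> * sqnorm v)\<^sup>2" by simp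
  also have "\<dots> = sqnorm (\<zeta> *s v) * sqnorm (\<omega> *s v)"
    by (simp add: sqnorm_scale power2_eq_square mult_ac)
  also have "\<dots> \<le> sqnorm (\<zeta> *s v)"
    using assms(2) sqnorm_nonneg[of "\<zeta> *s v"] by (simp add: mult_left_le)
  finally show False using assms(1) by simp
qed

text \<open>The polarised identity is the mixed derivative in \<zeta> and
  \<open>cnj \<omega>\<close> of \<open>log QIV_polar = \<mu> * log (1 - herm z w)\<close>.
  Integrating in \<zeta> from 0, where \<open>F 0 = 0\<close> makes the constant zero, leaves an
  equation of first order.\<close>

lemma radial_ode:
  assumes \<rho>: "0 < \<rho>" "\<rho> \<le> 1"
    and nz: "\<And>z w. sqnorm z < \<rho> \<Longrightarrow> sqnorm w < \<rho> \<Longrightarrow> QIV_polar (F z) (F w) \<noteq> 0"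
    and "sqnorm (\<zeta> *s v) < \<rho>" "sqnorm (\<omega> *s v) < \<rho>"
  defines "X \<equiv> F (\<omega> *s v)" and "U \<equiv> dF (\<omega> *s v) v"
  shows "(1 - \<zeta> * cnj \<omega> * of_real (sqnorm v)) * (bilin_sq (F (\<zeta> *s v)) * cnj (bil X U) / 2 - herm (F (\<zeta> *s v)) U)
    = - of_real (\<mu> * sqnorm v) * \<zeta> * QIV_polar (F (\<zeta> *s v)) X"
proof -
  let ?T = "{\<zeta>. sqnorm (\<zeta> *s v) < \<rho>}"
  let ?N = "of_real (sqnorm v) :: complex"
  define q where "q \<zeta> = QIV_polar (F (\<zeta> *s v)) X" for \<zeta>
  \<comment> \<open>\<open>r\<close> is the derivative of \<open>q\<close> with respect to
    \<open>cnj \<omega>\<close>.\<close>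
  define r where "r \<zeta> = bilin_sq (F (\<zeta> *s v)) * cnj (bil X U) / 2 - herm (F (\<zeta> *s v)) U" for \<zeta>
  define p where "p \<zeta> = 1 - \<zeta> * cnj \<omega> * ?N" for \<zeta>
  \<comment> \<open>The derivative in \<open>cnj \<omega>\<close> of
    \<open>log q - \<mu> * log p\<close>; the polarised identity says that it is constant in
    \<zeta>.\<close>
  define E where "E \<zeta> = r \<zeta> / q \<zeta> + of_real (\<mu> * sqnorm v) * \<zeta> / p \<zeta>" for \<zeta>
  have T: "convex ?T" using line_domain(2)[OF \<rho>(1), of 0 v] by simp
  have zero: "0 \<in> ?T" using \<rho>(1) by (simp add: sqnorm_def)
  have q0: "q \<zeta> \<noteq> 0" if "\<zeta> \<in> ?T" for \<zeta>
    using nz[of "\<zeta> *s v" "\<omega> *s v"] that assms(5) by (simp add: q_def X_def)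
  have p0: "p \<zeta> \<noteq> 0" if "\<zeta> \<in> ?T" for \<zeta>
    unfolding p_def using radial_kernel_nonzero[of \<zeta> v \<omega>] that assms(5) \<rho>(2) by simp
  have "(E has_field_derivative 0) (at \<zeta>)" if "\<zeta> \<in> ?T" for \<zeta>
  proof -
    have \<zeta>: "sqnorm (\<zeta> *s v) < 1" and \<omega>: "sqnorm (\<omega> *s v) < 1" using that assms(5) \<rho>(2) by simp_all
    define W V where "W = F (\<zeta> *s v)" and "V = dF (\<zeta> *s v) v"
    define q' where "q' = bil W V * cnj (bilin_sq X) / 2 - herm V X"
    define r' where "r' = bil W V * cnj (bil X U) - herm V U"
    note d = radial_derivatives[OF \<zeta>, folded W_def V_def]
    have dq: "(q has_field_derivative q') (at \<zeta>)"
      unfolding q_def[abs_def] q'_def by (rule d(3))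
    have dr: "(r has_field_derivative r') (at \<zeta>)"
      unfolding r_def[abs_def] r'_def by (auto intro!: derivative_eq_intros d)
    have dp: "(p has_field_derivative - cnj \<omega> * ?N) (at \<zeta>)"
      unfolding p_def[abs_def] by (auto intro!: derivative_eq_intros)
    have 1: "((\<lambda>\<zeta>. r \<zeta> / q \<zeta>) has_field_derivative (r' * q \<zeta> - r \<zeta> * q') / (q \<zeta> * q \<zeta>)) (at \<zeta>)"
      using DERIV_divide[OF dr dq q0[OF that]] .
    have dn: "((\<lambda>\<zeta>. of_real (\<mu> * sqnorm v) * \<zeta>) has_field_derivative of_real (\<mu> * sqnorm v)) (at \<zeta>)"
      by (auto intro!: derivative_eq_intros)
    have 2: "((\<lambda>\<zeta>. of_real (\<mu> * sqnorm v) * \<zeta> / p \<zeta>) has_field_derivative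
        (of_real (\<mu> * sqnorm v) * p \<zeta> - of_real (\<mu> * sqnorm v) * \<zeta> * (- cnj \<omega> * ?N)) / (p \<zeta> * p \<zeta>)) (at \<zeta>)"
      using DERIV_divide[OF dn dp p0[OF that]] .
    have "of_real (\<mu> * sqnorm v) * p \<zeta> - of_real (\<mu> * sqnorm v) * \<zeta> * (- cnj \<omega> * ?N) = of_real (\<mu> * sqnorm v)"
      by (simp add: p_def algebra_simps)
    moreover have "(p \<zeta>)\<^sup>2 * (q \<zeta> * r' - q' * r \<zeta>) + of_real (\<mu> * sqnorm v) * (q \<zeta>)\<^sup>2 = 0"
      using radial_polar_identity[OF \<zeta> \<omega>]
      unfolding p_def q_def r_def q'_def r'_def W_def V_def X_def U_def .
    ultimately have "(r' * q \<zeta> - r \<zeta> * q') / (q \<zeta> * q \<zeta>) +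
        (of_real (\<mu> * sqnorm v) * p \<zeta> - of_real (\<mu> * sqnorm v) * \<zeta> * (- cnj \<omega> * ?N)) / (p \<zeta> * p \<zeta>) = 0"
      using q0[OF that] p0[OF that]
      by (simp add: add_frac_eq) (simp add: algebra_simps power2_eq_square)
    then show ?thesis
      using DERIV_add[OF 1 2] unfolding E_def[abs_def] by simp
  qed
  then have "E \<zeta> = E 0"
    using has_field_derivative_zero_imp_const[OF T, of E \<zeta> 0] assms(4) zero by blast
  also have "E 0 = 0"
    by (simp add: E_def r_def F_zero herm_simps bilin_sq_eq_bil bil_simps)
  finally have "r \<zeta> / q \<zeta> + of_real (\<mu> * sqnorm v) * \<zeta> / p \<zeta> = 0" unfolding E_def .
  then have "p \<zeta> * r \<zeta> = - of_real (\<mu> * sqnorm v) * \<zeta> * q \<zeta>"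
    using q0[of \<zeta>] p0[of \<zeta>] assms(4)
    by (simp add: add_frac_eq) (simp add: algebra_simps add_eq_0_iff)
  then show ?thesis unfolding p_def q_def r_def .
qed

text \<open>Conjugating and exchanging the two points turns the equation into a linear differential
  equation in \<zeta> for the kernel itself, ready for the second integration.\<close>

lemma radial_ode':
  assumes \<rho>: "0 < \<rho>" "\<rho> \<le> 1"
    and nz: "\<And>z w. sqnorm z < \<rho> \<Longrightarrow> sqnorm w < \<rho> \<Longrightarrow> QIV_polar (F z) (F w) \<noteq> 0"
    and "sqnorm (\<zeta> *s v) < \<rho>" "sqnorm (\<omega> *s v) < \<rho>"
  defines "W \<equiv> F (\<zeta> *s v)" and "V \<equiv> dF (\<zeta> *s v) v" and "X \<equiv> F (\<omega> *s v)"
  shows "(1 - \<zeta> * cnj \<omega> * of_real (sqnorm v)) * (bil W V * cnj (bilin_sq X) / 2 - herm V X)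
    = - of_real (\<mu> * sqnorm v) * cnj \<omega> * QIV_polar W X"
proof -
  have "cnj (herm X V) = herm V X" "cnj (QIV_polar X W) = QIV_polar W X"
    by (simp_all add: herm_commute[of V X] herm_commute[of W X] QIV_polar_def mult.commute)
  with arg_cong[OF radial_ode[OF \<rho> nz assms(5,4)], of cnj]
  show ?thesis unfolding W_def[symmetric] V_def[symmetric] X_def[symmetric]
    by (simp add: mult_ac)
qed

end

section \<open>The exponent equals 1\<close>

lemma has_field_derivative_eq_on_open:
  fixes f g :: "complex \<Rightarrow> complex"
  assumes "(f has_field_derivative a) (at z)" "(g has_field_derivative b) (at z)"
    and "open T" "z \<in> T" "\<And>x. x \<in> T \<Longrightarrow> f x = g x"
  shows "a = b"
  using has_field_derivative_transform_within_open[OF assms(1,3,4,5)] assms(2) DERIV_unique by blast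

text \<open>Stated with degree bounds rather than exact degrees, so that it also covers factors
  whose top coefficient vanishes.\<close>

lemma coeff_mult_degree_le:
  assumes "degree p \<le> a" "degree q \<le> b"
  shows "coeff (p * q) (a + b) = coeff p a * coeff q b"
proof -
  have "coeff p i * coeff q (a + b - i) = (if i = a then coeff p a * coeff q b else 0)" for i
  proof (cases i a rule: linorder_cases)
    case less
    then have "b < a + b - i" by simp
    then have "coeff q (a + b - i) = 0" using assms(2) by (intro coeff_eq_0) simp
    then show ?thesis using less by simp
  next
    case greater
    then have "coeff p i = 0" using assms(1) by (intro coeff_eq_0) simp
    then show ?thesis using greater by simp
  qed simp
  then have "coeff (p * q) (a + b) = (\<Sum>i\<le>a + b. if i = a then coeff p a * coeff q b else 0)"
    unfolding coeff_mult by (intro sum.cong) auto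
  then show ?thesis by simp
qed

lemma linear_mult_pderiv_top:
  fixes p :: "complex poly"
  shows "degree ([:1, - s:] * pderiv p) \<le> degree p"
    and "coeff ([:1, - s:] * pderiv p) (degree p) = - s * of_nat (degree p) * lead_coeff p"
proof -
  have c: "coeff ([:1, - s:] * pderiv p) i = of_nat (Suc i) * coeff p (Suc i) - s * of_nat i * coeff p i" for i
    by (cases i) (simp_all add: coeff_pderiv)
  show "degree ([:1, - s:] * pderiv p) \<le> degree p"
    by (rule degree_le) (auto simp: c coeff_eq_0 simp del: mult_pCons_left)
  show "coeff ([:1, - s:] * pderiv p) (degree p) = - s * of_nat (degree p) * lead_coeff p"
    unfolding c by (simp add: coeff_eq_0)
qed

text \<open>If \<open>N / r\<^sup>2\<close> solves \<open>(1 - s x) q' = - m s q\<close>, i.e. is proportional to \<open>(1 - s x)\<^sup>m\<close>, then the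
  growth at infinity forces \<open>m\<close> to be an integer.\<close>

lemma rational_power_exponent:
  fixes N r :: "complex poly"
  assumes "[:1, - s:] * (pderiv N * r - 2 * N * pderiv r) + [:m * s:] * N * r = 0"
    and "N \<noteq> 0" "r \<noteq> 0" "s \<noteq> 0"
  shows "m = of_int (int (degree N) - 2 * int (degree r))"
proof -
  \<comment> \<open>The largest degree that can occur; comparing coefficients there determines
    \<open>m\<close>.\<close>
  let ?k = "degree N + degree r"
  let ?y = "[:1, - s:] * pderiv r"
  have gen: "a * (x * r - 2 * N * y) + c * N * r = (a * x) * r - (N * (a * y) + N * (a * y)) + c * (N * r)"
    for a c x y :: "complex poly"
    by (simp add: algebra_simps)
  have cc: "coeff ([:c:] * x) n = c * coeff x n" for c :: complex and x n
    by simp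
  have "0 = coeff (([:1, - s:] * pderiv N) * r - (N * ?y + N * ?y) + [:m * s:] * (N * r)) ?k"
    using assms(1) unfolding gen by (simp only: coeff_0)
  also have "\<dots> = coeff (([:1, - s:] * pderiv N) * r) ?k - 2 * coeff (N * ?y) ?k + m * s * coeff (N * r) ?k"
    by (simp only: coeff_add coeff_diff cc mult_2)
  also have "\<dots> = (- s * of_nat (degree N) * lead_coeff N) * lead_coeff r
      - 2 * (lead_coeff N * (- s * of_nat (degree r) * lead_coeff r)) + m * s * (lead_coeff N * lead_coeff r)"
    unfolding coeff_mult_degree_le[OF linear_mult_pderiv_top(1) order_refl]
      coeff_mult_degree_le[OF order_refl linear_mult_pderiv_top(1)] linear_mult_pderiv_top(2)
      coeff_mult_degree_le[OF order_refl order_refl] ..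
  also have "\<dots> = s * lead_coeff N * lead_coeff r * (m - of_int (int (degree N) - 2 * int (degree r)))"
    by (simp add: algebra_simps)
  finally show ?thesis using assms(2-4) by simp
qed

context IV_isometry
begin

lemma dF_0_add: "dF 0 (u + v) = dF 0 u + dF 0 v"
proof -
  have "linear (dF 0)"
    using F_has_derivative(1)[of 0] has_derivative_linear by (auto simp: sqnorm_def)
  then show ?thesis by (rule linear_add)
qed

lemma dF_0_scale: "dF 0 (c *s v) = c *s dF 0 v"
  by (rule F_has_derivative(2)) (simp add: sqnorm_def)

text \<open>A quadratic form in two complex variables has a nontrivial zero.\<close>

lemma isotropic_direction:
  assumes "CARD('n) \<ge> 2"
  obtains u where "u \<noteq> 0" "bil (dF 0 u) (dF 0 u) = 0"
proof -
  obtain i j :: 'n where ij: "i \<noteq> j"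
  proof -
    have "\<exists>i j :: 'n. i \<noteq> j"
    proof (rule ccontr)
      assume "\<not> ?thesis"
      then have "(UNIV :: 'n set) \<subseteq> {undefined}" by auto
      then have "CARD('n) \<le> card {undefined :: 'n}" by (intro card_mono) auto
      with assms show False by simp
    qed
    then show thesis using that by blast
  qed
  define x y where "x = dF 0 (axis i 1)" and "y = dF 0 (axis j 1)"
  have "\<exists>a b. (a \<noteq> 0 \<or> b \<noteq> 0) \<and> a\<^sup>2 * bil x x + 2 * a * b * bil x y + b\<^sup>2 * bil y y = 0"
  proof (cases "bil x x = 0")
    case True
    then show ?thesis by (intro exI[of _ 1] exI[of _ 0]) simp
  next
    case False
    \<comment> \<open>Quadratic formula for \<open>a\<close> with \<open>b = 1\<close>.\<close>
    define d where "d = csqrt ((bil x y)\<^sup>2 - bil x x * bil y y)"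
    have d: "d\<^sup>2 = (bil x y)\<^sup>2 - bil x x * bil y y" by (simp add: d_def)
    define a where "a = (d - bil x y) / bil x x"
    have "a * bil x x = d - bil x y" using False by (simp add: a_def)
    then have "bil x x * (a\<^sup>2 * bil x x + 2 * a * bil x y + bil y y) = 0"
      using d by algebra
    then show ?thesis using False by (intro exI[of _ a] exI[of _ 1]) simp
  qed
  then obtain a b where ab: "a \<noteq> 0 \<or> b \<noteq> 0" "a\<^sup>2 * bil x x + 2 * a * b * bil x y + b\<^sup>2 * bil y y = 0"
    by blast
  define u :: "complex ^ 'n" where "u = a *s axis i 1 + b *s axis j 1"
  have "u $ i = a" "u $ j = b" using ij by (simp_all add: u_def axis_def)
  then have "u \<noteq> 0" using ab(1) by (auto simp: vec_eq_iff)
  moreover have "dF 0 u = a *s x + b *s y"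
    by (simp add: u_def dF_0_add dF_0_scale x_def y_def)
  then have "bil (dF 0 u) (dF 0 u) = 0"
    using ab(2) by (simp add: bil_simps bil_commute[of y x] algebra_simps power2_eq_square)
  ultimately show ?thesis using that by blast
qed

end

locale IV_isometry_near_0 = IV_isometry F lam
  for F :: "complex ^ 'n \<Rightarrow> complex ^ 'm" and lam +
  fixes \<rho> :: real
  assumes \<rho>: "0 < \<rho>" "\<rho> \<le> 1"
    and QIV_polar_nz: "\<And>z w. sqnorm z < \<rho> \<Longrightarrow> sqnorm w < \<rho> \<Longrightarrow> QIV_polar (F z) (F w) \<noteq> 0"
begin

lemma ode:
  assumes "sqnorm (\<zeta> *s v) < \<rho>" "sqnorm (\<omega> *s v) < \<rho>"
  shows "(1 - \<zeta> * cnj \<omega> * of_real (sqnorm v)) *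
      (bil (F (\<zeta> *s v)) (dF (\<zeta> *s v) v) * cnj (bilin_sq (F (\<omega> *s v))) / 2 - herm (dF (\<zeta> *s v) v) (F (\<omega> *s v)))
    = - of_real (\<mu> * sqnorm v) * cnj \<omega> * QIV_polar (F (\<zeta> *s v)) (F (\<omega> *s v))"
  using \<rho> QIV_polar_nz assms by (rule radial_ode')

lemma radial_domain:
  "open {\<zeta>. sqnorm (\<zeta> *s v) < \<rho>}" "convex {\<zeta>. sqnorm (\<zeta> *s (v :: complex ^ 'n)) < \<rho>}"
  "0 \<in> {\<zeta>. sqnorm (\<zeta> *s v) < \<rho>}"
  using line_domain[OF \<rho>(1), of 0 v] \<rho>(1) by (simp_all add: sqnorm_def)

text \<open>Along an isotropic direction \<open>u\<close> the term \<open>F \<cdot> F\<close> drops out of the second-order expansion of the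
  functional equation, which then expresses \<open>\<mu> (1 - \<mu>)\<close> through the squared norm of the second
  derivative of \<open>F\<close>.\<close>

lemma \<mu>_le_1:
  assumes "CARD('n) \<ge> 2"
  shows "\<mu> \<le> 1"
proof -
  obtain u where u: "u \<noteq> 0" "bil (dF 0 u) (dF 0 u) = 0" using isotropic_direction[OF assms] .
  let ?T = "{\<zeta>. sqnorm (\<zeta> *s u) < \<rho>}"
  note T = radial_domain[of u]
  define N where "N = sqnorm u"
  have N: "N > 0" using u(1) sqnorm_eq_0_iff[of u] sqnorm_nonneg[of u] by (simp add: N_def)
  define V where "V \<zeta> = dF (\<zeta> *s u) u" for \<zeta>
  \<comment> \<open>The second derivative of \<open>F (\<zeta> *s u)\<close> at 0.\<close>
  define s where "s = (\<chi> j. deriv (\<lambda>\<zeta>. V \<zeta> $ j) 0)"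
  have V0: "V 0 = dF 0 u" by (simp add: V_def)
  have ds: "((\<lambda>\<zeta>. V \<zeta> $ j) has_field_derivative s $ j) (at 0)" for j
  proof -
    have "(\<lambda>\<zeta>. V \<zeta> $ j) holomorphic_on ?T"
      using dF_line_holomorphic[OF \<rho>, of 0 u] by (simp add: vec_holomorphic_on_def V_def)
    from holomorphic_derivI[OF this T(1,3)] show ?thesis by (simp add: s_def)
  qed
  have dherm: "((\<lambda>\<zeta>. herm (V \<zeta>) Y) has_field_derivative herm s Y) (at 0)" for Y
    unfolding herm_def by (auto intro!: derivative_eq_intros ds)
  have dFj: "((\<lambda>\<zeta>. F (\<zeta> *s u) $ j) has_field_derivative dF 0 u $ j) (at 0)" for j
    using F_line_derivative[of 0 0 u j] by (simp add: sqnorm_def)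
  have dbil: "((\<lambda>\<zeta>. bil (F (\<zeta> *s u)) (V \<zeta>)) has_field_derivative 0) (at 0)"
  proof -
    have "((\<lambda>\<zeta>. bil (F (\<zeta> *s u)) (V \<zeta>)) has_field_derivative
        (\<Sum>j\<in>UNIV. dF 0 u $ j * V 0 $ j + s $ j * F (0 *s u) $ j)) (at 0)"
      unfolding bil_def by (intro DERIV_sum DERIV_mult dFj ds)
    then show ?thesis using u(2) by (simp add: F_zero V0 bil_def)
  qed
  define K where "K = \<mu> * (1 - \<mu>) * N\<^sup>2"
  \<comment> \<open>Differentiate the first-order equation in \<zeta> at 0. Two further derivatives
    in \<omega> then yield \<open>herm s s = 2 * K\<close>, hence \<open>K\<close> is
    nonnegative.\<close>
  have second: "herm (F (\<omega> *s u)) s = of_real K * \<omega>\<^sup>2" if \<omega>: "sqnorm (\<omega> *s u) < \<rho>" for \<omega>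
  proof -
    define X where "X = F (\<omega> *s u)"
    define a where "a = cnj \<omega> * of_real N"
    have at0: "herm (dF 0 u) X = of_real \<mu> * a"
      using ode[of 0 u \<omega>] \<omega> \<rho>(1)
      by (simp add: X_def a_def N_def F_zero bil_simps QIV_polar_def herm_simps bilin_sq_eq_bil sqnorm_def mult_ac)
    have 1: "((\<lambda>\<zeta>. (1 - \<zeta> * cnj \<omega> * of_real N) * (bil (F (\<zeta> *s u)) (V \<zeta>) * cnj (bilin_sq X) / 2 - herm (V \<zeta>) X))
        has_field_derivative a * herm (dF 0 u) X - herm s X) (at 0)"
      by (auto intro!: derivative_eq_intros dbil dherm simp: F_zero bil_simps V0 a_def)
    have "((\<lambda>\<zeta>. QIV_polar (F (\<zeta> *s u)) X) has_field_derivative - herm (dF 0 u) X) (at 0)"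
      using radial_derivatives(3)[of 0 u X] by (simp add: F_zero bil_simps sqnorm_def)
    then have 2: "((\<lambda>\<zeta>. - of_real \<mu> * a * QIV_polar (F (\<zeta> *s u)) X)
        has_field_derivative - of_real \<mu> * a * (- herm (dF 0 u) X)) (at 0)"
      by (rule DERIV_cmult)
    have "a * herm (dF 0 u) X - herm s X = - of_real \<mu> * a * (- herm (dF 0 u) X)"
    proof (rule has_field_derivative_eq_on_open[OF 1 2 T(1,3)])
      fix \<zeta> assume "\<zeta> \<in> ?T"
      then show "(1 - \<zeta> * cnj \<omega> * of_real N) * (bil (F (\<zeta> *s u)) (V \<zeta>) * cnj (bilin_sq X) / 2 - herm (V \<zeta>) X)
          = - of_real \<mu> * a * QIV_polar (F (\<zeta> *s u)) X"
        using ode[of \<zeta> u \<omega>] \<omega> by (simp add: X_def V_def a_def N_def mult_ac)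
    qed
    then have "herm s X = of_real \<mu> * (1 - of_real \<mu>) * a\<^sup>2"
      unfolding at0 by (simp add: algebra_simps power2_eq_square)
    then have "cnj (herm s X) = of_real K * \<omega>\<^sup>2"
      by (simp add: K_def a_def power_mult_distrib mult_ac)
    then show ?thesis unfolding X_def[symmetric] herm_commute[of X s] .
  qed
  have first: "herm (V \<omega>) s = 2 * of_real K * \<omega>" if "\<omega> \<in> ?T" for \<omega>
  proof (rule has_field_derivative_eq_on_open[OF _ _ T(1) that])
    show "((\<lambda>\<zeta>. herm (F (\<zeta> *s u)) s) has_field_derivative herm (V \<omega>) s) (at \<omega>)"
      using radial_derivatives(1)[of \<omega> u s] that \<rho>(2) by (simp add: V_def)
    show "((\<lambda>\<omega>. of_real K * \<omega>\<^sup>2) has_field_derivative 2 * of_real K * \<omega>) (at \<omega>)"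
      by (auto intro!: derivative_eq_intros)
  qed (use second in auto)
  have "herm s s = 2 * of_real K"
  proof (rule has_field_derivative_eq_on_open[OF dherm _ T(1,3)])
    show "((\<lambda>\<omega>. 2 * of_real K * \<omega>) has_field_derivative 2 * of_real K) (at 0)"
      by (auto intro!: derivative_eq_intros)
  qed (use first in auto)
  then have "sqnorm s = 2 * K"
    unfolding herm_self by (metis of_real_eq_iff of_real_mult of_real_numeral)
  then have "0 \<le> \<mu> * (1 - \<mu>) * N\<^sup>2" using sqnorm_nonneg[of s] unfolding K_def by linarith
  then have "0 \<le> 1 - \<mu>"
    using \<mu>_pos N by (simp add: zero_le_mult_iff)
  then show ?thesis by simp
qed

text \<open>On a generic line, with the second argument of the kernel fixed, the kernel is a
  rational function solving the equation of \<open>(1 - s * \<zeta>) ^ \<mu>\<close>, so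
  \<open>rational_power_exponent\<close> applies.\<close>

lemma \<mu>_integer:
  assumes rep: "R \<noteq> 0" "\<And>z. sqnorm z < 1 \<Longrightarrow> cpoly_eval R z \<noteq> 0 \<Longrightarrow>
      F z = (\<chi> j. cpoly_eval (P j) z / cpoly_eval R z)"
  shows "\<exists>k::int. \<mu> = of_int k"
proof -
  \<comment> \<open>The coordinate factor, for an arbitrary index, forces the point chosen below to
    be nonzero as well as outside the zeros of \<open>R\<close>.\<close>
  have "R * cpoly_var undefined \<noteq> 0"
  proof
    assume "R * cpoly_var undefined = 0"
    then have "(cpoly_var undefined :: 'n cpoly) = 0"
      by (rule cpoly_mult_eq_0) (rule rep(1))
    then have "cpoly_eval (cpoly_var undefined :: 'n cpoly) (\<chi> i. 1) = 0" by (simp only: cpoly_eval_0)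
    then show False by simp
  qed
  then obtain v where "cpoly_eval (R * cpoly_var undefined) v \<noteq> 0"
    using cpoly_eval_inject[of "R * cpoly_var undefined" 0] by auto
  then have Rv: "cpoly_eval R v \<noteq> 0" and v0: "v \<noteq> 0" by (auto simp: cpoly_eval_mult)
  define N where "N = sqnorm v"
  have N: "N \<noteq> 0" using v0 sqnorm_eq_0_iff[of v] by (simp add: N_def)
  obtain r where r: "\<And>t. cpoly_eval R (0 + t *s v) = poly r t"
    using cpoly_eval_affine_line[of R 0 v] by blast
  have "\<forall>j. \<exists>p. \<forall>t. cpoly_eval (P j) (0 + t *s v) = poly p t"
    using cpoly_eval_affine_line by blast
  then obtain p where p: "\<And>j t. cpoly_eval (P j) (0 + t *s v) = poly (p j) t" by metis
  have r0: "r \<noteq> 0" using r[of 1] Rv by auto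
  obtain e where e: "e > 0" "\<And>t. cmod t < e \<Longrightarrow> sqnorm (t *s v) < \<rho>"
    using small_scale_in_ball[OF \<rho>(1)] by blast
  define \<omega> :: complex where "\<omega> = of_real (e / 2)"
  have \<omega>: "sqnorm (\<omega> *s v) < \<rho>" "\<omega> \<noteq> 0" using e by (auto simp: \<omega>_def)
  define X where "X = F (\<omega> *s v)"
  define s where "s = cnj \<omega> * of_real N"
  have s0: "s \<noteq> 0" using \<omega>(2) N by (simp add: s_def)
  \<comment> \<open>Numerator of the kernel over the denominator \<open>r\<^sup>2\<close>.\<close>
  define Q where "Q = r\<^sup>2 - r * (\<Sum>j\<in>UNIV. p j * [:cnj (X $ j):]) + [:cnj (bilin_sq X) / 4:] * (\<Sum>j\<in>UNIV. (p j)\<^sup>2)"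
  let ?T = "{\<zeta>. sqnorm (\<zeta> *s v) < \<rho>} \<inter> {\<zeta>. poly r \<zeta> \<noteq> 0}"
  have T: "open ?T"
    by (intro open_Int radial_domain open_Collect_neq continuous_intros)
  have Q: "poly Q \<zeta> = QIV_polar (F (\<zeta> *s v)) X * (poly r \<zeta>)\<^sup>2" if "\<zeta> \<in> ?T" for \<zeta>
  proof -
    have Fj: "F (\<zeta> *s v) $ j = poly (p j) \<zeta> / poly r \<zeta>" for j
      using rep(2)[of "\<zeta> *s v"] that \<rho>(2) r[of \<zeta>] p[of _ \<zeta>] by simp
    have h: "poly r \<zeta> * herm (F (\<zeta> *s v)) X = (\<Sum>j\<in>UNIV. poly (p j) \<zeta> * cnj (X $ j))"
      using that by (simp add: herm_def Fj sum_distrib_left)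
    have b: "(poly r \<zeta>)\<^sup>2 * bilin_sq (F (\<zeta> *s v)) = (\<Sum>j\<in>UNIV. (poly (p j) \<zeta>)\<^sup>2)"
      using that by (simp add: bilin_sq_def Fj sum_distrib_left power_divide)
    have "poly Q \<zeta> = (poly r \<zeta>)\<^sup>2 - poly r \<zeta> * (\<Sum>j\<in>UNIV. poly (p j) \<zeta> * cnj (X $ j))
        + cnj (bilin_sq X) / 4 * (\<Sum>j\<in>UNIV. (poly (p j) \<zeta>)\<^sup>2)"
      unfolding Q_def by (simp add: poly_sum mult.commute)
    then show ?thesis
      unfolding h[symmetric] b[symmetric] QIV_polar_def by (simp add: algebra_simps power2_eq_square)
  qed
  \<comment> \<open>The differential equation for \<open>Q / r\<^sup>2\<close> cleared of
    denominators.\<close>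
  define A where "A = [:1, - s:] * (pderiv Q * r - 2 * Q * pderiv r) + [:of_real \<mu> * s:] * Q * r"
  have A: "poly A \<zeta> = 0" if "\<zeta> \<in> ?T" for \<zeta>
  proof -
    define q' where "q' = bil (F (\<zeta> *s v)) (dF (\<zeta> *s v) v) * cnj (bilin_sq X) / 2 - herm (dF (\<zeta> *s v) v) X"
    define q where "q = QIV_polar (F (\<zeta> *s v)) X"
    have \<zeta>: "sqnorm (\<zeta> *s v) < \<rho>" "sqnorm (\<zeta> *s v) < 1" using that \<rho>(2) by auto
    have "poly (pderiv Q) \<zeta> = q' * (poly r \<zeta>)\<^sup>2 + 2 * poly r \<zeta> * poly (pderiv r) \<zeta> * q"
    proof (rule has_field_derivative_eq_on_open[OF poly_DERIV _ T that Q])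
      show "((\<lambda>\<zeta>. QIV_polar (F (\<zeta> *s v)) X * (poly r \<zeta>)\<^sup>2) has_field_derivative
          q' * (poly r \<zeta>)\<^sup>2 + 2 * poly r \<zeta> * poly (pderiv r) \<zeta> * q) (at \<zeta>)"
        unfolding q'_def q_def
        by (rule derivative_eq_intros radial_derivatives(3)[OF \<zeta>(2)] refl | simp)+
    qed
    moreover have "(1 - s * \<zeta>) * q' = - of_real \<mu> * s * q"
      using ode[OF \<zeta>(1) \<omega>(1)] by (simp add: q'_def q_def s_def N_def X_def mult_ac)
    moreover have "poly A \<zeta> = (1 - s * \<zeta>) * (poly (pderiv Q) \<zeta> * poly r \<zeta> - 2 * poly Q \<zeta> * poly (pderiv r) \<zeta>)
        + of_real \<mu> * s * poly Q \<zeta> * poly r \<zeta>"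
      by (simp add: A_def algebra_simps)
    ultimately show ?thesis
      unfolding Q[OF that] q_def[symmetric] by algebra
  qed
  \<comment> \<open>The factor \<open>r\<close> covers the roots of \<open>r\<close>, where nothing
    is known about \<open>A\<close>.\<close>
  have "A * r = 0"
  proof (rule poly_eq_0_near_0[OF e(1)])
    fix t assume "cmod t < e"
    then show "poly (A * r) t = 0" using A[of t] e(2)[of t] by auto
  qed
  then have A0: "A = 0" using r0 by simp
  have "Q \<noteq> 0"
  proof
    assume "Q = 0"
    have "poly r t = 0" if "cmod t < e" for t
      using Q[of t] e(2)[OF that] QIV_polar_nz[OF _ \<omega>(1), of "t *s v"] \<open>Q = 0\<close> by (auto simp: X_def)
    with poly_eq_0_near_0[OF e(1)] r0 show False by blast
  qed
  from rational_power_exponent[OF A0[unfolded A_def] this r0 s0]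
  show ?thesis by (metis of_real_eq_iff of_real_of_int_eq)
qed

text \<open>Second integration: for \<mu> = 1 the quotient \<open>QIV_polar (F (\<zeta> *s z)) (F z)
  / (1 - \<zeta> * sqnorm z)\<close> is constant in \<zeta>, and comparing \<zeta> = 0 with \<zeta>
  = 1 settles the diagonal. Polarisation then gives arbitrary pairs.\<close>

lemma polar_identity:
  assumes "\<mu> = 1" "sqnorm z < \<rho>" "sqnorm w < \<rho>"
  shows "QIV_polar (F z) (F w) = 1 - herm z w"
proof -
  have diag: "QIV_polar (F z) (F z) = 1 - herm z z" if z: "sqnorm z < \<rho>" for z
  proof -
    let ?T = "{\<zeta>. sqnorm (\<zeta> *s z) < \<rho>}"
    note T = radial_domain[of z]
    define p where "p \<zeta> = 1 - \<zeta> * of_real (sqnorm z)" for \<zeta> :: complex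
    define E where "E \<zeta> = QIV_polar (F (\<zeta> *s z)) (F z) / p \<zeta>" for \<zeta>
    have p0: "p \<zeta> \<noteq> 0" if "\<zeta> \<in> ?T" for \<zeta>
      using radial_kernel_nonzero[of \<zeta> z 1] that z \<rho>(2) by (simp add: p_def)
    have one: "1 \<in> ?T" using z by simp
    have "(E has_field_derivative 0) (at \<zeta>)" if "\<zeta> \<in> ?T" for \<zeta>
    proof -
      have \<zeta>: "sqnorm (\<zeta> *s z) < 1" "sqnorm (\<zeta> *s z) < \<rho>" using that \<rho>(2) by auto
      have dp: "(p has_field_derivative - of_real (sqnorm z)) (at \<zeta>)"
        unfolding p_def[abs_def] by (auto intro!: derivative_eq_intros)
      show ?thesis
        using DERIV_divide[OF radial_derivatives(3)[OF \<zeta>(1), of "F z"] dp p0[OF that]]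
          ode[OF \<zeta>(2), of 1] z
        unfolding E_def[abs_def] by (simp add: assms(1) p_def mult_ac)
    qed
    then have "E 1 = E 0"
      using has_field_derivative_zero_imp_const[OF T(2) _ one T(3)] by blast
    then show ?thesis
      using p0[OF one] by (simp add: E_def p_def F_zero QIV_polar_def herm_simps bilin_sq_eq_bil bil_simps herm_self)
  qed
  \<comment> \<open>The complex line through \<open>z\<close> and \<open>w\<close>, which sit at
    parameters 0 and 1.\<close>
  let ?x = "\<lambda>\<zeta>. z + \<zeta> *s (w - z)"
  let ?S = "{\<zeta>. sqnorm (?x \<zeta>) < \<rho>}"
  define G where "G \<zeta> \<omega> = QIV_polar (F (?x \<zeta>)) (F (?x \<omega>)) - (1 - herm (?x \<zeta>) (?x \<omega>))" for \<zeta> \<omega>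
  have hF: "vec_holomorphic_on ?S (\<lambda>\<zeta>. F (?x \<zeta>))"
    by (rule F_line_holomorphic[OF \<rho>(2)])
  have "sesqui ?S G"
    unfolding G_def[abs_def]
    by (intro sesqui_diff sesqui_const sesqui_QIV_polar[OF hF hF] sesqui_herm vec_holomorphic_affine)
  moreover have "G \<zeta> \<zeta> = 0" if "\<zeta> \<in> ?S" for \<zeta>
    using diag that by (simp add: G_def)
  moreover have "0 \<in> ?S" "1 \<in> ?S" using assms by simp_all
  ultimately have "G 0 1 = 0"
    using sesqui_polarisation[OF line_domain(1)[OF \<rho>(1)] convex_connected[OF line_domain(2)[OF \<rho>(1)]], of z "w - z" G 0 1]
    by blast
  then show ?thesis by (simp add: G_def)
qed

end

section \<open>The shape of the map\<close>

text \<open>A totally isotropic image is orthogonal to its complex conjugate, so the two meet only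
  in 0 and their dimensions add. Dimensions are real because conjugation is only real
  linear.\<close>

lemma isotropic_isometry_dim:
  fixes L :: "complex ^ 'n \<Rightarrow> complex ^ 'm"
  assumes add: "\<And>u v. L (u + v) = L u + L v" and scale: "\<And>c v. L (c *s v) = c *s L v"
    and iso: "\<And>u v. herm (L u) (L v) = herm u v" and zero: "\<And>v. bil (L v) (L v) = 0"
  shows "2 * CARD('n) \<le> CARD('m)"
proof -
  define cv :: "complex ^ 'm \<Rightarrow> complex ^ 'm" where "cv x = (\<chi> i. cnj (x $ i))" for x
  have smult: "r *\<^sub>R (x :: complex ^ 'k) = of_real r *s x" for r x
    by (simp add: vec_eq_iff scaleR_conv_of_real[where 'a = complex])
  have linL: "linear L"
    by (rule linearI) (simp_all add: add scale smult)
  have lincv: "linear cv"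
    by (rule linearI) (simp_all add: cv_def vec_eq_iff)
  have "inj L"
  proof (rule linear_injective_0[OF linL, THEN iffD2], intro allI impI)
    fix v assume "L v = 0"
    then have "herm v v = 0" using iso[of v v] by (simp add: herm_simps)
    then show "v = 0" by (simp add: herm_self sqnorm_eq_0_iff)
  qed
  have "inj cv" by (rule injI) (simp add: cv_def vec_eq_iff)
  have polar: "bil (L u) (L v) = 0" for u v
    using zero[of "u + v"] zero[of u] zero[of v] by (simp add: add bil_simps bil_commute[of "L v" "L u"])
  let ?A = "range L" and ?B = "cv ` range L"
  have sub: "subspace ?A" "subspace ?B"
    using linear_subspace_image[OF linL subspace_UNIV] linear_subspace_image[OF lincv] by blast+
  have "dim ?A = DIM(complex ^ 'n)"
    using dim_image_eq[OF linL, of UNIV] \<open>inj L\<close> by simp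
  moreover have "dim ?B = dim ?A"
    using dim_image_eq[OF lincv, of ?A] inj_on_subset[OF \<open>inj cv\<close>] by blast
  moreover have "?A \<inter> ?B = {0}"
  proof -
    have "x = 0" if "x \<in> ?A" "x \<in> ?B" for x
    proof -
      from that obtain u v where uv: "x = L u" "x = cv (L v)" by blast
      have "herm x x = herm (L u) (cv (L v))" using uv by simp
      also have "\<dots> = bil (L u) (L v)" by (simp add: herm_def bil_def cv_def)
      finally show ?thesis using polar by (simp add: herm_self sqnorm_eq_0_iff)
    qed
    then show ?thesis using subspace_0[OF sub(1)] subspace_0[OF sub(2)] by blast
  qed
  ultimately have "dim {x + y |x y. x \<in> ?A \<and> y \<in> ?B} = 2 * DIM(complex ^ 'n)"
    using dim_sums_Int[OF sub] by simp
  then have "2 * DIM(complex ^ 'n) \<le> DIM(complex ^ 'm)"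
    using dim_subset_UNIV[of "{x + y |x y. x \<in> ?A \<and> y \<in> ?B}"] by simp
  then show ?thesis by simp
qed

context IV_isometry_near_0
begin

text \<open>Derivative of \<open>polar_identity\<close> in the first variable at 0;
  \<open>bilin_sq (F z)\<close> has zero derivative there.\<close>

lemma herm_dF_0_F:
  assumes "\<mu> = 1" "sqnorm w < \<rho>"
  shows "herm (dF 0 u) (F w) = herm u w"
proof -
  have "- herm (dF 0 u) (F w) = - herm u w"
  proof (rule has_field_derivative_eq_on_open[OF _ _ radial_domain(1,3)[of u]])
    show "((\<lambda>\<zeta>. QIV_polar (F (\<zeta> *s u)) (F w)) has_field_derivative - herm (dF 0 u) (F w)) (at 0)"
      using radial_derivatives(3)[of 0 u "F w"] by (simp add: F_zero bil_simps sqnorm_def)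
    show "((\<lambda>\<zeta>. 1 - herm (\<zeta> *s u) w) has_field_derivative - herm u w) (at 0)"
      unfolding herm_simps by (auto intro!: derivative_eq_intros)
  qed (use polar_identity[OF assms(1) _ assms(2)] in auto)
  then show ?thesis by simp
qed

lemma herm_dF_0:
  assumes "\<mu> = 1"
  shows "herm (dF 0 u) (dF 0 v) = herm u v"
proof (rule has_field_derivative_eq_on_open[OF _ _ radial_domain(1,3)[of u]])
  show "((\<lambda>\<zeta>. herm (F (\<zeta> *s u)) (dF 0 v)) has_field_derivative herm (dF 0 u) (dF 0 v)) (at 0)"
    using radial_derivatives(1)[of 0 u "dF 0 v"] by (simp add: sqnorm_def)
  show "((\<lambda>\<zeta>. herm (\<zeta> *s u) v) has_field_derivative herm u v) (at 0)"
    unfolding herm_simps by (auto intro!: derivative_eq_intros)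
  fix \<zeta> assume "\<zeta> \<in> {\<zeta>. sqnorm (\<zeta> *s u) < \<rho>}"
  then have "herm (dF 0 v) (F (\<zeta> *s u)) = herm v (\<zeta> *s u)"
    using herm_dF_0_F[OF assms] by simp
  then show "herm (F (\<zeta> *s u)) (dF 0 v) = herm (\<zeta> *s u) v"
    unfolding herm_commute[of "F (\<zeta> *s u)"] herm_commute[of "\<zeta> *s u"] by simp
qed

text \<open>The nonlinear part \<open>F - dF 0\<close> is orthogonal to the image of \<open>dF 0\<close> and has the same Gram matrix as
  the scalar function \<open>F \<cdot> F / 2\<close>; hence it takes values in a single line.\<close>

lemma F_decomposition:
  assumes "\<mu> = 1" and v0: "bil (dF 0 v0) (dF 0 v0) \<noteq> 0"
  obtains a where "herm a a = 1" "\<And>u. herm (dF 0 u) a = 0"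
    "\<And>z. sqnorm z < \<rho> \<Longrightarrow> F z = dF 0 z + (bilin_sq (F z) / 2) *s a"
proof -
  define f where "f z = bilin_sq (F z) / 2" for z
  define H where "H z = F z - dF 0 z" for z
  have FF: "herm (F z) (F w) = herm z w + f z * cnj (f w)" if "sqnorm z < \<rho>" "sqnorm w < \<rho>" for z w
    using polar_identity[OF assms(1) that] by (simp add: QIV_polar_def f_def algebra_simps)
  have LH: "herm (dF 0 u) (H w) = 0" if "sqnorm w < \<rho>" for u w
    using herm_dF_0_F[OF assms(1) that] herm_dF_0[OF assms(1)] by (simp add: H_def herm_simps)
  have HL: "herm (H w) (dF 0 u) = 0" if "sqnorm w < \<rho>" for u w
    using LH[OF that, of u] herm_commute[of "H w" "dF 0 u"] by simp
  have HH: "herm (H z) (H w) = f z * cnj (f w)" if "sqnorm z < \<rho>" "sqnorm w < \<rho>" for z w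
  proof -
    have F: "F x = dF 0 x + H x" for x by (simp add: H_def)
    have "herm (F z) (F w) = herm z w + herm (H z) (H w)"
      unfolding F[of z] F[of w] using LH HL that herm_dF_0[OF assms(1)] by (simp add: herm_simps)
    then show ?thesis using FF[OF that] by simp
  qed
  \<comment> \<open>If \<open>f\<close> vanished near 0, so would \<open>H\<close>; then
    \<open>F = dF 0\<close> there, and \<open>f = 0\<close> would make small multiples of
    \<open>v0\<close> isotropic.\<close>
  have "\<exists>w. sqnorm w < \<rho> \<and> f w \<noteq> 0"
  proof (rule ccontr)
    assume "\<not> ?thesis"
    then have f0: "f w = 0" if "sqnorm w < \<rho>" for w using that by blast
    obtain e where e: "e > 0" "\<And>t. cmod t < e \<Longrightarrow> sqnorm (t *s v0) < \<rho>"
      using small_scale_in_ball[OF \<rho>(1)] by blast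
    define w where "w = of_real (e / 2) *s v0"
    have w: "sqnorm w < \<rho>" using e by (simp add: w_def)
    have "herm (H w) (H w) = 0" using HH[OF w w] f0[OF w] by simp
    then have "F w = dF 0 w" by (simp add: herm_self sqnorm_eq_0_iff H_def)
    then have "bil (dF 0 w) (dF 0 w) = 0"
      using f0[OF w] by (simp add: f_def bilin_sq_eq_bil)
    then show False
      using v0 e(1) by (simp add: w_def dF_0_scale bil_simps)
  qed
  then obtain w0 where w0: "sqnorm w0 < \<rho>" "f w0 \<noteq> 0" by blast
  define a where "a = (1 / f w0) *s H w0"
  show ?thesis
  proof
    show aa: "herm a a = 1"
      using w0 by (simp add: a_def herm_simps HH)
    show "herm (dF 0 u) a = 0" for u
      using LH[OF w0(1)] by (simp add: a_def herm_simps)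
    fix z :: "complex ^ 'n" assume z: "sqnorm z < \<rho>"
    have Ha: "herm (H z) a = f z"
      using w0 HH[OF z w0(1)] by (simp add: a_def herm_simps)
    have aH: "herm a (H z) = cnj (f z)"
      using Ha herm_commute[of a "H z"] by simp
    \<comment> \<open>The distance of \<open>H z\<close> from the line of \<open>a\<close> is zero:
      the equality case of Cauchy-Schwarz.\<close>
    have "herm (H z - f z *s a) (H z - f z *s a) = 0"
      using HH[OF z z] Ha aH aa by (simp add: herm_simps algebra_simps)
    then have "H z = f z *s a"
      by (simp add: herm_self sqnorm_eq_0_iff)
    then show "F z = dF 0 z + (bilin_sq (F z) / 2) *s a"
      by (simp add: H_def f_def algebra_simps)
  qed
qed

end

section \<open>The degree computed from the algebraic form of the map\<close>

lemma nonsquare_quadratic: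
  fixes M r :: "complex poly"
  assumes "M * M = [:1, - 2 * \<beta>, \<beta>\<^sup>2 - d:] * ((r * r) * (r * r))" "d \<noteq> 0" "r \<noteq> 0"
  shows False
proof -
  define E where "E = [:1, - 2 * \<beta>, \<beta>\<^sup>2 - d:]"
  have E0: "E \<noteq> 0" by (simp add: E_def)
  \<comment> \<open>If the quadratic coefficient vanishes, then \<open>\<beta>\<^sup>2 = d\<close>
    is nonzero and the linear one survives.\<close>
  have "degree E \<noteq> 0"
    using assms(2) by (auto simp: E_def)
  then obtain x where x: "poly E x = 0"
    using alg_closed_imp_poly_has_root[of E] by auto
  \<comment> \<open>The discriminant is \<open>4 * d\<close>, so every root is simple. At such a
    root the right side has odd order and the square \<open>M * M\<close> even order.\<close>
  have "poly (pderiv E) x \<noteq> 0"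
  proof
    assume "poly (pderiv E) x = 0"
    then have 1: "2 * (\<beta>\<^sup>2 - d) * x = 2 * \<beta>"
      by (simp add: E_def pderiv_pCons algebra_simps)
    have 2: "1 - 2 * \<beta> * x + (\<beta>\<^sup>2 - d) * x\<^sup>2 = 0"
      using x by (simp add: E_def algebra_simps power2_eq_square)
    have "\<beta> * x = 1" using 1 2 by algebra
    then have "d * x\<^sup>2 = 0" using 2 by algebra
    then show False using assms(2) \<open>\<beta> * x = 1\<close> by auto
  qed
  then have ordE: "order x E = 1"
    using order_pderiv[OF E0 x] order_0I by simp
  have rr: "r * r \<noteq> 0" "r * r * (r * r) \<noteq> 0" "E * (r * r * (r * r)) \<noteq> 0"
    using assms(3) E0 by simp_all
  have "order x (E * (r * r * (r * r))) = 1 + 4 * order x r"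
    using ordE order_mult[OF rr(3)] order_mult[OF rr(2)] order_mult[OF rr(1)] by simp
  moreover have MM: "M * M \<noteq> 0" using rr(3) assms(1) by (simp add: E_def)
  have "order x (M * M) = 2 * order x M" using order_mult[OF MM] by simp
  ultimately have "2 * order x M = 1 + 4 * order x r"
    using assms(1) by (simp add: E_def)
  then show False by presburger
qed

lemma complex_linear_coordinates:
  fixes l :: "complex ^ 'n \<Rightarrow> complex"
  assumes "\<And>u v. l (u + v) = l u + l v" "\<And>c v. l (c *s v) = c * l v"
  shows "l z = (\<Sum>i\<in>UNIV. l (axis i 1) * z $ i)"
proof -
  have "l 0 = 0" using assms(2)[of 0 0] by simp
  then have sum: "l (\<Sum>i\<in>A. g i) = (\<Sum>i\<in>A. l (g i))" for A :: "'n set" and g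
    by (induction A rule: infinite_finite_induct) (simp_all add: assms(1))
  have "z = (\<Sum>i\<in>UNIV. (z $ i) *s axis i 1)"
    by (simp add: basis_expansion)
  then have "l z = l (\<Sum>i\<in>UNIV. (z $ i) *s axis i 1)" by simp
  also have "\<dots> = (\<Sum>i\<in>UNIV. l (axis i 1) * z $ i)"
    by (simp add: sum assms(2) mult.commute)
  finally show ?thesis .
qed

text \<open>The algebraic remainder of the problem once \<mu> = 1, with \<open>L\<close> in the role
  of \<open>dF 0\<close>; it is treated by polynomial identities near 0.\<close>

locale quadric_graph =
  fixes F :: "complex ^ 'n \<Rightarrow> complex ^ 'm" and L :: "complex ^ 'n \<Rightarrow> complex ^ 'm" and a :: "complex ^ 'm"
    and \<rho> :: real and P :: "'m \<Rightarrow> 'n cpoly" and R :: "'n cpoly" and v0 :: "complex ^ 'n"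
  assumes L_add: "L (u + v) = L u + L v" and L_scale: "L (c *s v) = c *s L v"
    and a_unit: "herm a a = 1" and L_perp_a: "herm (L u) a = 0" and v0: "bil (L v0) (L v0) \<noteq> 0"
    and \<rho>_pos: "0 < \<rho>" and F_eq: "sqnorm z < \<rho> \<Longrightarrow> F z = L z + (bilin_sq (F z) / 2) *s a"
    and R_nonzero: "R \<noteq> 0"
    and F_rational: "sqnorm z < \<rho> \<Longrightarrow> cpoly_eval R z \<noteq> 0 \<Longrightarrow> F z = (\<chi> j. cpoly_eval (P j) z / cpoly_eval R z)"
    and lowest: "(\<And>j. d dvd P j) \<Longrightarrow> d dvd R \<Longrightarrow> d dvd 1"
begin

definition Lp :: "'m \<Rightarrow> 'n cpoly" where
  "Lp j = cpoly_linear (\<lambda>i. L (axis i 1) $ j)"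

definition b :: "'n \<Rightarrow> complex" where
  "b i = bil (L (axis i 1)) a"

definition qp :: "'n cpoly" where
  "qp = (\<Sum>j\<in>UNIV. Lp j * Lp j)"

definition D :: "'n cpoly" where
  "D = 1 - cpoly_linear b"

text \<open>Numerator over \<open>D\<close> of component \<open>j\<close> of
  \<open>L + q a / (2 D)\<close>, where \<open>q\<close> is the function of
  \<open>qp\<close>.\<close>

definition Q :: "'m \<Rightarrow> 'n cpoly" where
  "Q j = Lp j * D + cpoly_const (a $ j / 2) * qp"

lemma eval_Lp: "cpoly_eval (Lp j) z = L z $ j"
  unfolding Lp_def cpoly_eval_linear
  by (rule complex_linear_coordinates[symmetric]) (simp_all add: L_add L_scale)

lemma eval_b: "cpoly_eval (cpoly_linear b) z = bil (L z) a"
  unfolding b_def cpoly_eval_linear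
  by (rule complex_linear_coordinates[symmetric]) (simp_all add: L_add L_scale bil_simps)

lemma eval_qp: "cpoly_eval qp z = bil (L z) (L z)"
  by (simp add: qp_def cpoly_eval_sum cpoly_eval_mult eval_Lp bil_def)

lemma eval_D: "cpoly_eval D z = 1 - bil (L z) a"
  by (simp add: D_def cpoly_eval_diff eval_b)

lemma eval_Q: "cpoly_eval (Q j) z = L z $ j * (1 - bil (L z) a) + a $ j / 2 * bil (L z) (L z)"
  by (simp add: Q_def cpoly_eval_add cpoly_eval_mult eval_Lp eval_D eval_qp)

lemma qp_nonzero: "qp \<noteq> 0"
  using v0 eval_qp[of v0] by auto

lemma quadratic_equation:
  assumes "sqnorm z < \<rho>"
  defines "f \<equiv> bilin_sq (F z) / 2"
  shows "2 * f = bil (L z) (L z) + 2 * bil (L z) a * f + bil a a * f\<^sup>2"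
proof -
  have "2 * f = bilin_sq (F z)" by (simp add: f_def)
  also have "\<dots> = bilin_sq (L z + f *s a)" using F_eq[OF assms(1)] by (simp add: f_def)
  also have "\<dots> = bil (L z) (L z) + 2 * bil (L z) a * f + bil a a * f\<^sup>2"
    by (simp add: bilin_sq_eq_bil bil_simps bil_commute[of a "L z"] algebra_simps power2_eq_square)
  finally show ?thesis .
qed

text \<open>Otherwise \<open>F \<cdot> F\<close> would be a root of a quadratic equation whose discriminant is not a square on a
  generic line through the origin.\<close>

lemma a_isotropic: "bil a a = 0"
proof (rule ccontr)
  assume c0: "bil a a \<noteq> 0"
  define c where "c = bil a a"
  \<comment> \<open>Along \<open>v\<close> the denominator must not vanish identically, and
    \<open>qp\<close> must be nonzero to keep the discriminant from being a square.\<close>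
  have "R * qp \<noteq> 0" using cpoly_mult_eq_0[of R qp] R_nonzero qp_nonzero by blast
  then obtain v where "cpoly_eval (R * qp) v \<noteq> 0"
    using cpoly_eval_inject[of "R * qp" 0] by auto
  then have Rv: "cpoly_eval R v \<noteq> 0" and qv: "bil (L v) (L v) \<noteq> 0"
    by (auto simp: cpoly_eval_mult eval_qp)
  define \<beta> \<kappa> where "\<beta> = bil (L v) a" and "\<kappa> = bil (L v) (L v)"
  obtain r where r: "\<And>t. cpoly_eval R (0 + t *s v) = poly r t"
    using cpoly_eval_affine_line[of R 0 v] by blast
  have "\<forall>j. \<exists>p. \<forall>t. cpoly_eval (P j) (0 + t *s v) = poly p t"
    using cpoly_eval_affine_line by blast
  then obtain p where p: "\<And>j t. cpoly_eval (P j) (0 + t *s v) = poly (p j) t" by metis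
  have r0: "r \<noteq> 0" using r[of 1] Rv by auto
  obtain e where e: "e > 0" "\<And>t. cmod t < e \<Longrightarrow> sqnorm (t *s v) < \<rho>"
    using small_scale_in_ball[OF \<rho>_pos] by blast
  \<comment> \<open>Completing the square: \<open>M\<close> stands for
    \<open>(c * f + t * \<beta> - 1) * r\<^sup>2\<close>, whose square is the discriminant times
    \<open>r ^ 4\<close>.\<close>
  define M where "M = [:c / 2:] * (\<Sum>j\<in>UNIV. (p j)\<^sup>2) + [:- 1, \<beta>:] * (r * r)"
  have "poly ((M * M - [:1, - 2 * \<beta>, \<beta>\<^sup>2 - c * \<kappa>:] * ((r * r) * (r * r))) * r) t = 0" if t: "cmod t < e" for t
  proof (cases "poly r t = 0")
    case False
    define f where "f = bilin_sq (F (t *s v)) / 2"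
    have eq: "2 * f = t\<^sup>2 * \<kappa> + 2 * (t * \<beta>) * f + c * f\<^sup>2"
      using quadratic_equation[OF e(2)[OF t]]
      by (simp add: f_def L_scale bil_simps \<beta>_def \<kappa>_def c_def power2_eq_square mult_ac)
    have "F (t *s v) $ j = poly (p j) t / poly r t" for j
      using F_rational[OF e(2)[OF t]] False r[of t] p[of _ t] by simp
    then have "2 * f * (poly r t)\<^sup>2 = (\<Sum>j\<in>UNIV. (poly (p j) t)\<^sup>2)"
      using False by (simp add: f_def bilin_sq_def sum_distrib_right power_divide)
    then have "poly M t = c / 2 * (2 * f * (poly r t)\<^sup>2) + (t * \<beta> - 1) * (poly r t)\<^sup>2"
      by (simp add: M_def poly_sum algebra_simps power2_eq_square)
    then have M: "poly M t = (c * f + t * \<beta> - 1) * (poly r t)\<^sup>2" by (simp add: algebra_simps)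
    have "(c * f + t * \<beta> - 1)\<^sup>2 = 1 - 2 * \<beta> * t + (\<beta>\<^sup>2 - c * \<kappa>) * t\<^sup>2"
      using eq by algebra
    then have "(poly M t)\<^sup>2 = (1 - 2 * \<beta> * t + (\<beta>\<^sup>2 - c * \<kappa>) * t\<^sup>2) * ((poly r t)\<^sup>2)\<^sup>2"
      by (simp add: M power_mult_distrib)
    then have z: "poly (M * M - [:1, - 2 * \<beta>, \<beta>\<^sup>2 - c * \<kappa>:] * ((r * r) * (r * r))) t = 0"
      by (simp add: power2_eq_square algebra_simps)
    show ?thesis unfolding poly_mult[of _ r] z by simp
  qed simp
  from poly_eq_0_near_0[OF e(1) this]
  have "M * M = [:1, - 2 * \<beta>, \<beta>\<^sup>2 - c * \<kappa>:] * ((r * r) * (r * r))"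
    using r0 by simp
  from nonsquare_quadratic[OF this _ r0] show False
    using c0 qv by (simp add: c_def \<kappa>_def)
qed

text \<open>With \<open>bil a a = 0\<close> the quadratic equation becomes linear in
  \<open>f\<close>, with coefficient \<open>2 * D\<close>.\<close>

lemma F_times_D:
  assumes "sqnorm z < \<rho>"
  shows "F z $ j * cpoly_eval D z = cpoly_eval (Q j) z"
proof -
  define f where "f = bilin_sq (F z) / 2"
  have q: "bil (L z) (L z) = 2 * f * (1 - bil (L z) a)"
    using quadratic_equation[OF assms] by (simp add: a_isotropic f_def algebra_simps)
  have Fj: "F z $ j = L z $ j + f * a $ j"
    using arg_cong[OF F_eq[OF assms], of "\<lambda>x. x $ j"] by (simp add: f_def)
  show ?thesis unfolding eval_D eval_Q q Fj by (simp add: algebra_simps)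
qed

lemma P_times_D: "P j * D = Q j * R"
proof -
  \<comment> \<open>The extra factor \<open>R\<close> makes the identity trivial at zeros of
    \<open>R\<close>, where the quotient formula for \<open>F\<close> is silent.\<close>
  have "R * (P j * D) = R * (Q j * R)"
  proof (rule cpoly_eq_near_0[OF \<rho>_pos])
    fix z :: "complex ^ 'n" assume z: "sqnorm z < \<rho>"
    show "cpoly_eval (R * (P j * D)) z = cpoly_eval (R * (Q j * R)) z"
    proof (cases "cpoly_eval R z = 0")
      case False
      then have "cpoly_eval (P j) z = F z $ j * cpoly_eval R z"
        using F_rational[OF z] by simp
      then show ?thesis using F_times_D[OF z, of j] by (simp add: cpoly_eval_mult)
    qed (simp add: cpoly_eval_mult)
  qed
  then have "R * (P j * D - Q j * R) = 0" by (simp add: right_diff_distrib)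
  then show ?thesis using cpoly_mult_eq_0[OF _ R_nonzero] by fastforce
qed

text \<open>No cancellation: if \<open>R\<close> were nonzero somewhere on the hyperplane
  \<open>D = 0\<close>, every \<open>Q j\<close> would vanish on all of it, hence so would
  \<open>qp\<close>; by homogeneity \<open>qp\<close> would be zero.\<close>

lemma R_vanishes_with_D:
  assumes "cpoly_eval D z = 0"
  shows "cpoly_eval R z = 0"
proof (rule ccontr)
  assume R: "cpoly_eval R z \<noteq> 0"
  let ?V = "{y. cpoly_eval D y = 0}"
  have line: "x + t *s (y - x) \<in> ?V" if "x \<in> ?V" "y \<in> ?V" for x y t
  proof -
    define d where "d = y - x"
    have "bil (L y) a = bil (L x) a + bil (L d) a"
      using L_add[of x d] by (simp add: d_def bil_simps)
    then have "bil (L d) a = 0" using that by (simp add: eval_D)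
    then have "bil (L (x + t *s d)) a = bil (L x) a"
      by (simp add: L_add L_scale bil_simps)
    then show ?thesis using that by (simp add: eval_D flip: d_def)
  qed
  \<comment> \<open>On \<open>D = 0\<close> the numerator \<open>Q j\<close> reduces to
    \<open>a $ j / 2\<close> times \<open>qp\<close>.\<close>
  obtain j where j: "a $ j \<noteq> 0"
    using a_unit by (force simp: herm_def)
  have q0: "bil (L y) (L y) = 0" if "y \<in> ?V" for y
  proof -
    have "cpoly_eval R x * cpoly_eval (Q j) x = 0" if "x \<in> ?V" for x
      using arg_cong[OF P_times_D[of j], of "\<lambda>p. cpoly_eval p x"] that by (auto simp: cpoly_eval_mult)
    from cpoly_eval_prod_zero_on_affine[of ?V, OF line this _ R that]
    have "cpoly_eval (Q j) y = 0" using assms by simp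
    then show ?thesis using that j by (simp add: eval_Q eval_D)
  qed
  have "cpoly_linear b * qp = 0"
  proof (rule cpoly_eval_inject)
    fix v
    show "cpoly_eval (cpoly_linear b * qp) v = cpoly_eval 0 v"
    proof (cases "bil (L v) a = 0")
      case False
      \<comment> \<open>Rescaling moves \<open>v\<close> into the hyperplane and multiplies
        \<open>qp\<close> by a nonzero constant.\<close>
      then have "(1 / bil (L v) a) *s v \<in> ?V"
        by (simp add: eval_D L_scale bil_simps)
      from q0[OF this] have "bil (L v) (L v) = 0"
        using False by (simp add: L_scale bil_simps)
      then show ?thesis by (simp add: cpoly_eval_mult eval_qp)
    qed (simp add: cpoly_eval_mult eval_b)
  qed
  moreover have "cpoly_linear b \<noteq> 0"
    using assms eval_b[of z] by (auto simp: eval_D)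
  ultimately show False using cpoly_mult_eq_0 qp_nonzero by blast
qed

lemma cpoly_deg_D: "cpoly_deg D \<le> 1"
proof -
  have eq: "D = cpoly_const 1 + cpoly_linear (\<lambda>i. - b i)"
    by (rule cpoly_eval_inject)
      (simp add: D_def cpoly_eval_diff cpoly_eval_add cpoly_eval_linear sum_negf)
  show ?thesis
    unfolding eq by (rule cpoly_deg_add[OF cpoly_deg_const cpoly_deg_linear])
qed

lemma cpoly_deg_Q: "cpoly_deg (Q j) \<le> 2"
proof -
  have l: "cpoly_deg (Lp j) \<le> 1" for j unfolding Lp_def by (rule cpoly_deg_linear)
  have "cpoly_deg (Lp j * D) \<le> 2"
    using cpoly_deg_mult[OF l cpoly_deg_D] unfolding one_add_one .
  moreover have "cpoly_deg qp \<le> 2"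
    unfolding qp_def by (rule cpoly_deg_sum) (rule cpoly_deg_mult[OF l l, unfolded one_add_one])
  then have "cpoly_deg (cpoly_const (a $ j / 2) * qp) \<le> 2"
    using cpoly_deg_mult[OF cpoly_deg_const[of _ 0]] by simp
  ultimately show ?thesis unfolding Q_def by (rule cpoly_deg_add)
qed

text \<open>The cofactor of \<open>D\<close> in \<open>R\<close> also divides every
  \<open>P j\<close>, so lowest terms make it a unit.\<close>

lemma P_R_eq:
  obtains k where "k \<noteq> 0" "R = D * cpoly_const k" "\<And>j. P j = Q j * cpoly_const k"
proof -
  obtain S where S: "R = D * S"
    using cpoly_vanishing_on_hyperplane[of b R] R_vanishes_with_D unfolding D_def by blast
  have D0: "D \<noteq> 0" using eval_D[of 0] L_scale[of 0 0] by (auto simp: bil_simps)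
  have P: "P j = Q j * S" for j
  proof -
    have "D * (P j - Q j * S) = 0"
      using P_times_D[of j] S by (simp add: algebra_simps)
    then show ?thesis using cpoly_mult_eq_0[OF _ D0] by fastforce
  qed
  have "S dvd 1" by (rule lowest) (simp_all add: P S)
  then obtain k where "k \<noteq> 0" "S = cpoly_const k" by (rule cpoly_unit_const)
  with S P that show ?thesis by blast
qed

lemma rep_deg_eq_2: "rep_deg P R = 2"
proof -
  obtain k where k: "k \<noteq> 0" "R = D * cpoly_const k" "\<And>j. P j = Q j * cpoly_const k"
    using P_R_eq by blast
  have "cpoly_deg (P j) \<le> 2" for j
    unfolding k(3) using cpoly_deg_mult[OF cpoly_deg_Q[of j] cpoly_deg_const[of k 0]] by simp
  moreover have "cpoly_deg R \<le> 2"
    unfolding k(2) using cpoly_deg_mult[OF cpoly_deg_D cpoly_deg_const[of k 0]] by simp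
  ultimately have "rep_deg P R \<le> 2" by (simp add: rep_deg_def)
  moreover have "\<not> rep_deg P R \<le> 1"
  proof
    assume "rep_deg P R \<le> 1"
    then have deg: "cpoly_deg (P j) \<le> 1" for j by (simp add: rep_deg_def)
    define \<beta> \<kappa> where "\<beta> = bil (L v0) a" and "\<kappa> = bil (L v0) (L v0)"
    \<comment> \<open>Degree at most 1 kills the coefficient of \<open>t\<^sup>2\<close> of
      \<open>P j\<close> along \<open>v0\<close>. Pairing the resulting vector equation with
      \<open>a\<close>, which is orthogonal to \<open>L v0\<close>, gives \<kappa> = 0.\<close>
    have top: "a $ j * \<kappa> = 2 * \<beta> * L v0 $ j" for j
    proof -
      obtain r where r: "degree r \<le> 1" "\<And>t. cpoly_eval (P j) (t *s v0) = poly r t"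
        using cpoly_eval_line[OF deg[of j]] by blast
      have "poly r t = poly [:0, k * L v0 $ j, k * (a $ j / 2 * \<kappa> - L v0 $ j * \<beta>):] t" for t
        unfolding r(2)[symmetric] k(3)
        by (simp add: cpoly_eval_mult eval_Q L_scale bil_simps \<beta>_def \<kappa>_def algebra_simps)
      then have "r = [:0, k * L v0 $ j, k * (a $ j / 2 * \<kappa> - L v0 $ j * \<beta>):]"
        by (intro poly_eq_poly_eq_iff[THEN iffD1] ext)
      then have "coeff r 2 = k * (a $ j / 2 * \<kappa> - L v0 $ j * \<beta>)" by (simp add: numeral_2_eq_2)
      moreover have "coeff r 2 = 0" using r(1) by (intro coeff_eq_0) simp
      ultimately show ?thesis using k(1) by (simp add: algebra_simps)
    qed
    have "\<kappa> * herm a a = (\<Sum>j\<in>UNIV. a $ j * \<kappa> * cnj (a $ j))"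
      by (simp add: herm_def sum_distrib_left mult_ac)
    also have "\<dots> = (\<Sum>j\<in>UNIV. 2 * \<beta> * L v0 $ j * cnj (a $ j))" by (simp only: top)
    also have "\<dots> = 2 * \<beta> * herm (L v0) a"
      by (simp add: herm_def sum_distrib_left mult_ac)
    finally show False using a_unit L_perp_a v0 by (simp add: \<kappa>_def)
  qed
  ultimately show ?thesis by simp
qed

end

theorem mainTheorem9:
  fixes F :: "complex ^ 'n \<Rightarrow> complex ^ 'm"
  assumes "3 \<le> CARD('n) + 1" and "CARD('n) + 1 \<le> CARD('m)" and "CARD('m) < 2 * CARD('n)"
    and "holomorphic_isometry_IV F"
    and "rational_map_on unit_ball_C F"
    and "F 0 = 0"
  shows "\<forall>P R. lowest_terms_rep unit_ball_C F P R \<longrightarrow> rep_deg P R = 2"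
proof (intro allI impI)
  fix P :: "'m \<Rightarrow> 'n cpoly" and R :: "'n cpoly"
  assume rep: "lowest_terms_rep unit_ball_C F P R"
  obtain lam where "IV_isometry F lam"
    using assms(4,6) unfolding holomorphic_isometry_IV_def IV_isometry_def by blast
  then interpret IV_isometry F lam .
  obtain \<rho> where \<rho>: "0 < \<rho>" "\<rho> \<le> 1"
    and nz: "\<And>z w. sqnorm z < \<rho> \<Longrightarrow> sqnorm w < \<rho> \<Longrightarrow> QIV_polar (F z) (F w) \<noteq> 0"
    using QIV_polar_nonzero_near_0 by blast
  interpret IV_isometry_near_0 F lam \<rho>
    by unfold_locales (use \<rho> nz in auto)
  have R0: "R \<noteq> 0"
    and quot: "\<And>z. sqnorm z < 1 \<Longrightarrow> cpoly_eval R z \<noteq> 0 \<Longrightarrow> F z = (\<chi> j. cpoly_eval (P j) z / cpoly_eval R z)"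
    and low: "\<And>d. (\<And>j. d dvd P j) \<Longrightarrow> d dvd R \<Longrightarrow> d dvd 1"
    using rep unfolding lowest_terms_rep_def unit_ball_C_def by auto
  obtain k :: int where k: "\<mu> = of_int k" using \<mu>_integer[OF R0 quot] by blast
  have "\<mu> \<le> 1" using \<mu>_le_1 assms(1) by simp
  with k \<mu>_pos have \<mu>: "\<mu> = 1" by simp
  \<comment> \<open>Otherwise the image of \<open>dF 0\<close> would be totally isotropic, forcing
    \<open>2 * CARD('n) \<le> CARD('m)\<close>.\<close>
  obtain v0 where v0: "bil (dF 0 v0) (dF 0 v0) \<noteq> 0"
    using isotropic_isometry_dim[of "dF 0", OF dF_0_add dF_0_scale herm_dF_0[OF \<mu>]] assms(3) by force
  obtain a where a: "herm a a = 1" "\<And>u. herm (dF 0 u) a = 0"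
    "\<And>z. sqnorm z < \<rho> \<Longrightarrow> F z = dF 0 z + (bilin_sq (F z) / 2) *s a"
    using F_decomposition[OF \<mu> v0] by blast
  interpret quadric_graph F "dF 0" a \<rho> P R v0
  proof
    show "F z = (\<chi> j. cpoly_eval (P j) z / cpoly_eval R z)" if "sqnorm z < \<rho>" "cpoly_eval R z \<noteq> 0" for z
      using quot that \<rho>(2) by simp
  qed (use dF_0_add dF_0_scale a v0 \<rho> R0 low in auto)
  show "rep_deg P R = 2" by (rule rep_deg_eq_2)
qed

end
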